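(* Let $\alpha\in(0,1)$, $\beta>1$ and $H>0$ be real numbers, let $\{K_n\}_{n\ge 1}$ be the sequence of closed subsets of $\mathbb{R}$ associated with $\beta$ as defined in the context, let $\{\Lambda_n\}_{n\geq 1}$ be an increasing sequence of real numbers with $\Lambda_n\ge 2^{(1-\alpha)\beta n}$ for every $n$, and let $\mathbb{X}$ be the complete metric space of functions defined in the context (depending on $\alpha,\beta,H,\{\Lambda_n\}$). Then the following statements hold true. 1. For every $f\in\mathbb{X}$, the derivative $f'$ is approximately differentiable at almost every $x\in\mathbb{R}$. 2. If in addition $(\alpha+1)\beta<2$, then the set of all functions $f\in\mathbb{X}$ with the property that for every $g:\mathbb{R}\to\mathbb{R}$ of class $C^{1,1}$ (namely of class $C^1$ with $g'$ Lipschitz continuous), the coincidence set $\{x\in\mathbb{R}: f(x)=g(x)\}$ has Lebesgue measure equal to $0$, is residual in $\mathbb{X}$.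
   Context: For integers $n\ge 1$ and $j\in\mathbb{Z}$ let $$I_{n,j}:=\left(\frac{j}{2^n}-\frac{1}{2^{\beta n}},\ \frac{j}{2^n}+\frac{1}{2^{\beta n}}\right),\qquad U_n:=\bigcup_{j\in\mathbb{Z}}I_{n,j},\qquad \widehat{U}_n:=\bigcup_{i=n}^{+\infty}U_i,\qquad K_n:=\mathbb{R}\setminus\widehat{U}_n .$$ $C^1_b(\mathbb{R})$ is the Banach space of functions $f:\mathbb{R}\to\mathbb{R}$ of class $C^1$ such that $f$ and $f'$ are bounded, with norm $\|f\|_{C^1_b(\mathbb{R})}:=\sup_{x\in\mathbb{R}}|f(x)|+\sup_{x\in\mathbb{R}}|f'(x)|$. $\mathbb{X}$ is the set of all $f\in C^1_b(\mathbb{R})$ such that - $f'(x)\ge 0$ for every $x\in\mathbb{R}$; - $|f'(x)-f'(y)|\le H|x-y|^{\alpha}$ for every $(x,y)\in\mathbb{R}^2$; - $|f'(x)-f'(y)|\le \Lambda_n|x-y|$ for every $n\ge 1$ and every $(x,y)\in K_n^2$. It is a closed subset of $C^1_b(\mathbb{R})$, and it is considered as a complete metric space with the distance inherited from $C^1_b(\mathbb{R})$. A measurable function $\varphi:\mathbb{R}\to\mathbb{R}$ is approximately differentiable at $x$ if there exists $a\in\mathbb{R}$ such that for every $\varepsilon>0$ the set $\{y: |\varphi(y)-\varphi(x)-a(y-x)|>\varepsilon|y-x|\}$ has Lebesgue density $0$ at $x$. A subset of a complete metric space is residual if its complement is contained in a countable union of closed sets with empty interior. *)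

theory Defs
  imports "HOL-Analysis.Analysis"
begin

definition Int_nj :: "real \<Rightarrow> nat \<Rightarrow> int \<Rightarrow> real set" where
  "Int_nj \<beta> n j = {of_int j / 2 ^ n - 1 / 2 powr (\<beta> * real n)
                    <..< of_int j / 2 ^ n + 1 / 2 powr (\<beta> * real n)}"

definition U_set :: "real \<Rightarrow> nat \<Rightarrow> real set" where
  "U_set \<beta> n = (\<Union>j. Int_nj \<beta> n j)"

definition U_hat :: "real \<Rightarrow> nat \<Rightarrow> real set" where
  "U_hat \<beta> n = (\<Union>i\<in>{n..}. U_set \<beta> i)"

definition K_set :: "real \<Rightarrow> nat \<Rightarrow> real set" where
  "K_set \<beta> n = UNIV - U_hat \<beta> n"

definition C1b :: "(real \<Rightarrow> real) set" where
  "C1b = {f. f C1_differentiable_on UNIV \<and> bounded (range f) \<and> bounded (range (deriv f))}"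

definition C1b_norm :: "(real \<Rightarrow> real) \<Rightarrow> real" where
  "C1b_norm f = (SUP x. \<bar>f x\<bar>) + (SUP x. \<bar>deriv f x\<bar>)"

text \<open>
  The value 0 off C1b is a dummy: the locale \<^locale>\<open>Metric_space\<close> requires symmetry and
  nonnegativity of the distance on the whole type, where \<^const>\<open>deriv\<close> and suprema
  may take unspecified values.
\<close>

definition C1b_dist :: "(real \<Rightarrow> real) \<Rightarrow> (real \<Rightarrow> real) \<Rightarrow> real" where
  "C1b_dist f g = (if f \<in> C1b \<and> g \<in> C1b then C1b_norm (\<lambda>x. f x - g x) else 0)"

definition X_space :: "real \<Rightarrow> real \<Rightarrow> real \<Rightarrow> (nat \<Rightarrow> real) \<Rightarrow> (real \<Rightarrow> real) set" where
  "X_space \<alpha> \<beta> H \<Lambda> = {f \<in> C1b.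
     (\<forall>x. deriv f x \<ge> 0) \<and>
     (\<forall>x y. \<bar>deriv f x - deriv f y\<bar> \<le> H * \<bar>x - y\<bar> powr \<alpha>) \<and>
     (\<forall>n\<ge>1. \<forall>x\<in>K_set \<beta> n. \<forall>y\<in>K_set \<beta> n.
        \<bar>deriv f x - deriv f y\<bar> \<le> \<Lambda> n * \<bar>x - y\<bar>)}"

abbreviation X_topology :: "real \<Rightarrow> real \<Rightarrow> real \<Rightarrow> (nat \<Rightarrow> real) \<Rightarrow> (real \<Rightarrow> real) topology" where
  "X_topology \<alpha> \<beta> H \<Lambda> \<equiv> Metric_space.mtopology (X_space \<alpha> \<beta> H \<Lambda>) C1b_dist"

text \<open>
  Outside the locale \<^locale>\<open>Metric_space\<close> the topology above is meaningful only if the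
  metric axioms hold, which the following lemmas establish.
\<close>

lemma C1b_DERIV:
  assumes "f \<in> C1b"
  shows "(f has_field_derivative deriv f x) (at x)"
proof -
  obtain D where "(f has_field_derivative D x) (at x)"
    using assms
    by (auto simp: C1b_def C1_differentiable_on_def has_real_derivative_iff_has_vector_derivative)
  then show ?thesis by (simp add: DERIV_imp_deriv)
qed

lemma C1b_bdd:
  assumes "f \<in> C1b"
  obtains B C where "\<And>x. \<bar>f x\<bar> \<le> B" "\<And>x. \<bar>deriv f x\<bar> \<le> C"
  using assms that by (auto simp: C1b_def bounded_iff)

lemma Metric_space_C1b: "Metric_space C1b C1b_dist"
proof -
  have dd: "deriv (\<lambda>x. f x - g x) = (\<lambda>x. deriv f x - deriv g x)" if "f \<in> C1b" "g \<in> C1b" for f g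
    by (rule ext, rule DERIV_imp_deriv) (intro DERIV_diff C1b_DERIV that)
  have bf: "bdd_above (range (\<lambda>x. \<bar>f x - g x\<bar>))"
    and bd: "bdd_above (range (\<lambda>x. \<bar>deriv f x - deriv g x\<bar>))" if fg: "f \<in> C1b" "g \<in> C1b" for f g
  proof -
    obtain B C where 1: "\<And>x. \<bar>f x\<bar> \<le> B" "\<And>x. \<bar>deriv f x\<bar> \<le> C" using C1b_bdd[OF fg(1)] by blast
    obtain B' C' where 2: "\<And>x. \<bar>g x\<bar> \<le> B'" "\<And>x. \<bar>deriv g x\<bar> \<le> C'" using C1b_bdd[OF fg(2)] by blast
    have b: "\<bar>f x - g x\<bar> \<le> B + B'" "\<bar>deriv f x - deriv g x\<bar> \<le> C + C'" for x
      using 1[of x] 2[of x] by linarith+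
    show "bdd_above (range (\<lambda>x. \<bar>f x - g x\<bar>))" "bdd_above (range (\<lambda>x. \<bar>deriv f x - deriv g x\<bar>))"
      by (rule bdd_aboveI2[OF b(1)], rule bdd_aboveI2[OF b(2)])
  qed
  have D: "C1b_dist f g = (SUP x. \<bar>f x - g x\<bar>) + (SUP x. \<bar>deriv f x - deriv g x\<bar>)"
    if "f \<in> C1b" "g \<in> C1b" for f g
    using that by (simp add: C1b_dist_def C1b_norm_def dd)
  have up: "\<bar>f x - g x\<bar> \<le> (SUP x. \<bar>f x - g x\<bar>)"
    "\<bar>deriv f x - deriv g x\<bar> \<le> (SUP x. \<bar>deriv f x - deriv g x\<bar>)" if "f \<in> C1b" "g \<in> C1b" for f g x
    by (rule cSUP_upper[OF UNIV_I bf[OF that]], rule cSUP_upper[OF UNIV_I bd[OF that]])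
  have nn: "0 \<le> (SUP x. \<bar>f x - g x\<bar>)" "0 \<le> (SUP x. \<bar>deriv f x - deriv g x\<bar>)"
    if "f \<in> C1b" "g \<in> C1b" for f g
    using up[OF that, of 0] by linarith+
  have off: "C1b_dist f g = 0" if "\<not> (f \<in> C1b \<and> g \<in> C1b)" for f g
    using that by (auto simp: C1b_dist_def)
  have comm: "C1b_dist f g = C1b_dist g f" for f g
    by (cases "f \<in> C1b \<and> g \<in> C1b") (auto simp: D off abs_minus_commute)
  have pos: "0 \<le> C1b_dist f g" for f g
    by (cases "f \<in> C1b \<and> g \<in> C1b") (auto simp: D off intro!: add_nonneg_nonneg nn)
  have tri: "C1b_dist f h \<le> C1b_dist f g + C1b_dist g h"
    if f: "f \<in> C1b" and g: "g \<in> C1b" and h: "h \<in> C1b" for f g h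
  proof -
    have "(SUP x. \<bar>f x - h x\<bar>) \<le> (SUP x. \<bar>f x - g x\<bar>) + (SUP x. \<bar>g x - h x\<bar>)"
    proof (rule cSUP_least)
      fix x show "\<bar>f x - h x\<bar> \<le> (SUP x. \<bar>f x - g x\<bar>) + (SUP x. \<bar>g x - h x\<bar>)"
        using up(1)[OF f g, of x] up(1)[OF g h, of x] by linarith
    qed simp
    moreover have "(SUP x. \<bar>deriv f x - deriv h x\<bar>)
        \<le> (SUP x. \<bar>deriv f x - deriv g x\<bar>) + (SUP x. \<bar>deriv g x - deriv h x\<bar>)"
    proof (rule cSUP_least)
      fix x show "\<bar>deriv f x - deriv h x\<bar>
        \<le> (SUP x. \<bar>deriv f x - deriv g x\<bar>) + (SUP x. \<bar>deriv g x - deriv h x\<bar>)"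
        using up(2)[OF f g, of x] up(2)[OF g h, of x] by linarith
    qed simp
    ultimately show ?thesis using f g h by (simp add: D)
  qed
  have zero: "C1b_dist f g = 0 \<longleftrightarrow> f = g" if fg: "f \<in> C1b" "g \<in> C1b" for f g
  proof
    assume "C1b_dist f g = 0"
    then have "(SUP x. \<bar>f x - g x\<bar>) = 0" using D[OF fg] nn[OF fg] by linarith
    then show "f = g" using up(1)[OF fg] by (intro ext) fastforce
  next
    assume "f = g" then show "C1b_dist f g = 0" using fg by (simp add: D)
  qed
  show ?thesis
    by unfold_locales (use pos comm zero tri in auto)
qed

lemma Metric_space_X: "Metric_space (X_space \<alpha> \<beta> H \<Lambda>) C1b_dist"
  by (rule Metric_space.subspace[OF Metric_space_C1b]) (auto simp: X_space_def)

text \<open>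
  Two-sided density. Measurability of the set is part of the notion, since
  \<^const>\<open>measure\<close> is 0 on nonmeasurable sets.
\<close>

definition has_lebesgue_density :: "real set \<Rightarrow> real \<Rightarrow> real \<Rightarrow> bool" where
  "has_lebesgue_density E x d \<longleftrightarrow> E \<in> sets lebesgue \<and>
     ((\<lambda>r. measure lebesgue (E \<inter> ball x r) / measure lebesgue (ball x r)) \<longlongrightarrow> d) (at_right 0)"

definition approx_differentiable_at :: "(real \<Rightarrow> real) \<Rightarrow> real \<Rightarrow> bool" where
  "approx_differentiable_at \<phi> x \<longleftrightarrow> \<phi> \<in> borel_measurable lebesgue \<and>
     (\<exists>a. \<forall>\<epsilon>>0. has_lebesgue_density
        {y. \<bar>\<phi> y - \<phi> x - a * (y - x)\<bar> > \<epsilon> * \<bar>y - x\<bar>} x 0)"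

definition residual_in :: "'a topology \<Rightarrow> 'a set \<Rightarrow> bool" where
  "residual_in T A \<longleftrightarrow> A \<subseteq> topspace T \<and>
     (\<exists>\<F>. countable \<F> \<and> (\<forall>C\<in>\<F>. closedin T C \<and> T interior_of C = {}) \<and>
          topspace T - A \<subseteq> \<Union>\<F>)"

definition C11 :: "(real \<Rightarrow> real) set" where
  "C11 = {g. g C1_differentiable_on UNIV \<and> (\<exists>L. L-lipschitz_on UNIV (deriv g))}"

end

(* Where f agrees with a function g of class C^{1,1}, almost every point x is a density point of
   the coincidence set, so f'(x) = g'(x) and at every small scale 2^-n some t of that order has
   |f(x+t) - f(x) - f'(x) t| <= N 4^-n. The functions for which this holds on a set of measure at
   least 1/N form a closed set. It has empty interior: interpolating f' linearly over the gaps of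
   K_n keeps f in X, nearly unchanged, but makes f' Lipschitz; adding a small multiple of a function
   whose derivative consists of tents inside the intervals of U_k then produces an increment of order
   2^(-(1+alpha) beta k) at scale 2^-k, which dominates 4^-k because (1+alpha) beta < 2.
   For the approximate differentiability, the gap interpolation of f' from K_n is Lipschitz,
   hence differentiable almost everywhere, and K_n has density 1 at almost all of its points. *)
theory Submission
  imports Defs
begin

text \<open>Membership in \<open>X_space\<close> is rigid: every modification has to keep the same
  \<open>H\<close> and the same \<open>\<Lambda> n\<close>. Two facts leave room. Linear
  interpolation over the gaps of a closed set preserves every concave modulus of continuity, so one
  construction respects the Hoelder bound and the Lipschitz bounds; and \<open>X_space\<close> is
  convex, so the bumps enter through \<open>(1 - \<delta>) * f1 + \<delta> * w\<close> rather than
  through a sum. Smoothing must precede the bumps: a general member only has a Taylor error of order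
  a^(1+\<alpha>) at scale a = 2^-k, which can hide the bump increment of order \<rho>^(1+\<alpha>),
  where \<rho> = 2^(-\<beta> k) < a; after smoothing the error is of order a^2. Outside
  \<open>U_set \<beta> k\<close> the derivative of the bump function vanishes, so nothing
  compensates its increment, and contact survives only inside \<open>U_set \<beta> k\<close>, whose
  measure in a bounded window is of order 2^((1-\<beta>) k). Steps t between 2 * 2^-n and 4 * 2^-n
  are long enough to pass over a whole bump next to x. The density theorem and the differentiation
  of Lipschitz functions both come from one covering estimate.\<close>

section \<open>Covering, density and differentiation\<close>

text \<open>The admissible short intervals inside an open set \<open>G\<close> slightly larger than
  \<open>N\<close> form a Vitali cover. A disjoint countable subfamily covers \<open>N\<close> up to
  a Lebesgue null set, which absolute continuity makes \<open>\<nu>\<close>-null, and its total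
  length is at most that of \<open>G\<close>. The intervals need not be centred at
  \<open>x\<close>.\<close>

lemma Vitali_measure_le:
  fixes \<nu> :: "real measure" and p :: real
  assumes sets: "sets \<nu> = sets borel" and ac: "absolutely_continuous lborel \<nu>"
    and N: "N \<in> sets borel" and fin: "emeasure lborel N < \<infinity>" and p: "0 \<le> p"
    and small: "\<And>x d. x \<in> N \<Longrightarrow> d > 0 \<Longrightarrow>
      \<exists>a b. a < x \<and> x < b \<and> b - a < d \<and> emeasure \<nu> {a<..<b} \<le> ennreal (p * (b - a))"
  shows "emeasure \<nu> N \<le> ennreal p * emeasure lborel N"
proof -
  have *: "emeasure \<nu> N \<le> ennreal p * (emeasure lborel N + ennreal e)" if e: "e > 0" for e :: real
  proof -
    obtain G where G: "open G" "N \<subseteq> G" "emeasure lborel (G - N) < ennreal e"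
      using outer_regular_lborel[OF N e] by auto
    define K where "K = {(a, b). a < b \<and> {a<..<b} \<subseteq> G \<and> emeasure \<nu> {a<..<b} \<le> ennreal (p * (b - a))}"
    define mid rad :: "real \<times> real \<Rightarrow> real" where "mid i = (fst i + snd i) / 2" and "rad i = (snd i - fst i) / 2" for i
    have ball: "ball (mid i) (rad i) = {fst i <..< snd i}" for i
      by (auto simp: mid_def rad_def ball_def dist_real_def abs_if field_simps split: if_splits)
    have "\<exists>i. i \<in> K \<and> x \<in> ball (mid i) (rad i) \<and> rad i < d" if x: "x \<in> N" "d > 0" for x d
    proof -
      obtain r where r: "r > 0" "ball x r \<subseteq> G" using G x by (meson in_mono openE)
      obtain a b where ab: "a < x" "x < b" "b - a < min d r" "emeasure \<nu> {a<..<b} \<le> ennreal (p * (b - a))"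
        using small[OF x(1), of "min d r"] r x by auto
      have "{a<..<b} \<subseteq> ball x r" using ab by (auto simp: dist_real_def)
      then have "(a, b) \<in> K" using ab r by (auto simp: K_def)
      moreover have "x \<in> ball (mid (a,b)) (rad (a,b))" unfolding ball using ab by auto
      moreover have "rad (a,b) < d" using ab by (auto simp: rad_def)
      ultimately show ?thesis by blast
    qed
    then obtain C where C: "countable C" "C \<subseteq> K"
        "pairwise (\<lambda>i j. disjnt (ball (mid i) (rad i)) (ball (mid j) (rad j))) C"
        "negligible (N - (\<Union>i\<in>C. ball (mid i) (rad i)))"
      by (rule Vitali_covering_theorem_balls)
    define I where "I i = {fst i <..< snd i}" for i :: "real \<times> real"
    define V where "V = (\<Union>i\<in>C. I i)"
    have V: "V \<in> sets borel" "V \<subseteq> G" unfolding V_def I_def using C(2)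
      by (fastforce simp: K_def intro!: borel_open)+
    have dis: "disjoint_family_on I C"
      using C(3) unfolding ball I_def[symmetric]
      by (auto simp: disjoint_family_on_def pairwise_def disjnt_def)
    have NV: "N - V \<in> null_sets lborel"
      using C(4) N V(1) unfolding ball I_def[symmetric] V_def[symmetric] negligible_iff_null_sets
      by (simp add: null_sets_completion_iff)
    then have NV\<nu>: "N - V \<in> null_sets \<nu>" using ac by (auto simp: absolutely_continuous_def)
    have "emeasure \<nu> N \<le> emeasure \<nu> (V \<union> (N - V))"
      by (rule emeasure_mono) (use V N sets in auto)
    also have "\<dots> \<le> emeasure \<nu> V"
      using NV\<nu> V N sets by (metis emeasure_Un_null_set order_refl sets_lborel)
    also have "\<dots> = (\<integral>\<^sup>+i. emeasure \<nu> (I i) \<partial>count_space C)"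
      unfolding V_def by (rule emeasure_UN_countable[OF _ C(1) dis]) (auto simp: sets I_def)
    also have "\<dots> \<le> (\<integral>\<^sup>+i. ennreal p * emeasure lborel (I i) \<partial>count_space C)"
      by (rule nn_integral_mono) (use C(2) p in \<open>auto simp: K_def I_def ennreal_mult\<close>)
    also have "\<dots> = ennreal p * (\<integral>\<^sup>+i. emeasure lborel (I i) \<partial>count_space C)"
      by (rule nn_integral_cmult) auto
    also have "(\<integral>\<^sup>+i. emeasure lborel (I i) \<partial>count_space C) = emeasure lborel V"
      unfolding V_def by (rule emeasure_UN_countable[OF _ C(1) dis, symmetric]) (auto simp: I_def)
    also have "emeasure lborel V \<le> emeasure lborel (N \<union> (G - N))"
      by (rule emeasure_mono) (use V N G in auto)
    also have "\<dots> \<le> emeasure lborel N + emeasure lborel (G - N)"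
      by (rule emeasure_subadditive) (use N G in auto)
    also have "\<dots> \<le> emeasure lborel N + ennreal e" using G by (simp add: add_left_mono less_imp_le)
    finally show ?thesis by (simp add: mult_left_mono)
  qed
  obtain m where m: "emeasure lborel N = ennreal m" "m \<ge> 0" using fin by (cases "emeasure lborel N") auto
  show ?thesis
  proof (rule ennreal_le_epsilon)
    fix e :: real assume e: "e > 0"
    \<comment> \<open>Dividing by \<open>p + 1\<close> instead of \<open>p\<close> also covers
      \<open>p = 0\<close>.\<close>
    have "ennreal p * (emeasure lborel N + ennreal (e / (p + 1))) = ennreal (p * m + p * (e / (p + 1)))"
      using m p e by (simp add: ennreal_plus[symmetric] ennreal_mult[symmetric] distrib_left del: ennreal_plus)
    also have "\<dots> \<le> ennreal (p * m + e)"
      using p e by (intro ennreal_leI) (simp add: field_simps)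
    finally show "emeasure \<nu> N \<le> ennreal p * emeasure lborel N + ennreal e"
      using *[of "e / (p + 1)"] e p m
      by (simp add: ennreal_plus ennreal_mult)
  qed
qed

text \<open>Lebesgue's density theorem for intervals that contain \<open>x\<close> anywhere, not
  only at the centre. Apply \<open>Vitali_measure_le\<close> to Lebesgue measure restricted to
  \<open>E\<close>: for the bad set N it gives |N| \<le> p |N| with p < 1.\<close>

lemma AE_density:
  fixes E :: "real set"
  assumes E: "E \<in> sets borel"
  shows "AE x in lborel. x \<in> E \<longrightarrow> (\<forall>e>0. \<exists>d>0. \<forall>a b. a < x \<and> x < b \<and> b - a < d \<longrightarrow>
    measure lborel (E \<inter> {a<..<b}) \<ge> (1 - e) * (b - a))"
proof -
  define \<nu> where "\<nu> = density lborel (indicator E)"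
  have \<nu>: "emeasure \<nu> A = emeasure lborel (E \<inter> A)" if "A \<in> sets borel" for A
    unfolding \<nu>_def using that E
    by (simp add: emeasure_density indicator_inter_arith[symmetric])
  \<comment> \<open>A union of open intervals, hence open: the bad set is Borel without any study of
    how the ratios depend on \<open>x\<close>.\<close>
  define Op where "Op k n = \<Union>{{a<..<b} |a b. a < b \<and> b - a < 1 / Suc n \<and>
      measure lborel (E \<inter> {a<..<b}) < (1 - 1 / Suc k) * (b - a)}" for k n :: nat
  have Op: "open (Op k n)" for k n unfolding Op_def by (rule open_Union) auto
  define N where "N k j = E \<inter> (\<Inter>n. Op k n) \<inter> {- real j..real j}" for k j :: nat
  have "N k j \<in> null_sets lborel" for k j
  proof -
    have meas: "N k j \<in> sets borel" unfolding N_def using E Op by auto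
    have fin: "emeasure lborel (N k j) < \<infinity>"
    proof -
      have "emeasure lborel (N k j) \<le> emeasure lborel {- real j..real j}"
        by (rule emeasure_mono) (auto simp: N_def)
      also have "\<dots> < \<infinity>" by simp
      finally show ?thesis .
    qed
    have "emeasure \<nu> (N k j) \<le> ennreal (1 - 1 / Suc k) * emeasure lborel (N k j)"
    proof (rule Vitali_measure_le[OF _ _ meas fin])
      show "absolutely_continuous lborel \<nu>" unfolding \<nu>_def
        by (rule absolutely_continuousI_density) (use E in auto)
      fix x d :: real assume "x \<in> N k j" "d > 0"
      obtain n where n: "1 / Suc n < d" using \<open>d > 0\<close> nat_approx_posE by blast
      have "x \<in> Op k n" using \<open>x \<in> N k j\<close> by (auto simp: N_def)
      then obtain a b where ab: "a < x" "x < b" "b - a < 1 / Suc n"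
          "measure lborel (E \<inter> {a<..<b}) < (1 - 1 / Suc k) * (b - a)"
        by (auto simp: Op_def)
      have "emeasure lborel (E \<inter> {a<..<b}) < \<infinity>"
        by (rule le_less_trans[OF emeasure_mono[of _ "{a<..<b}"]]) (use ab in auto)
      then have "emeasure \<nu> {a<..<b} = ennreal (measure lborel (E \<inter> {a<..<b}))"
        by (subst \<nu>) (auto intro!: emeasure_eq_ennreal_measure)
      also have "\<dots> \<le> ennreal ((1 - 1 / Suc k) * (b - a))" using ab(4) by (intro ennreal_leI) auto
      finally show "\<exists>a b. a < x \<and> x < b \<and> b - a < d \<and> emeasure \<nu> {a<..<b} \<le> ennreal ((1 - 1 / Suc k) * (b - a))"
        using ab n by (intro exI[of _ a] exI[of _ b]) auto
    qed (auto simp: \<nu>_def)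
    moreover have "emeasure \<nu> (N k j) = emeasure lborel (N k j)"
      using meas by (simp add: \<nu>) (simp add: N_def inf_assoc[symmetric] Int_absorb1)
    moreover obtain m where m: "emeasure lborel (N k j) = ennreal m" "m \<ge> 0"
      using fin by (cases "emeasure lborel (N k j)") auto
    ultimately have "ennreal m \<le> ennreal ((1 - 1 / Suc k) * m)" by (simp add: ennreal_mult')
    then have "m \<le> (1 - 1 / Suc k) * m" using m by (subst (asm) ennreal_le_iff) auto
    then have "m = 0" using m by (simp add: field_simps)
    then show ?thesis using m meas by (auto simp: null_sets_def)
  qed
  then have "(\<Union>k j. N k j) \<in> null_sets lborel" by blast
  then show ?thesis
  proof (rule AE_I', intro subsetI, goal_cases)
    case (1 x)
    then obtain e where xE: "x \<in> E" and e: "e > 0" and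
      ex: "\<And>d. d > 0 \<Longrightarrow> \<exists>a b. a < x \<and> x < b \<and> b - a < d \<and> measure lborel (E \<inter> {a<..<b}) < (1 - e) * (b - a)"
      by (auto simp: not_le)
    obtain k where k: "1 / Suc k < e" using e nat_approx_posE by blast
    obtain j where j: "\<bar>x\<bar> \<le> real j" using real_arch_simple by blast
    have "x \<in> Op k n" for n
    proof -
      obtain a b where ab: "a < x" "x < b" "b - a < 1 / Suc n" "measure lborel (E \<inter> {a<..<b}) < (1 - e) * (b - a)"
        using ex[of "1 / Suc n"] by auto
      have "(1 - e) * (b - a) \<le> (1 - 1 / Suc k) * (b - a)" using ab k by (intro mult_right_mono) auto
      then have "a < b \<and> b - a < 1 / Suc n \<and> measure lborel (E \<inter> {a<..<b}) < (1 - 1 / Suc k) * (b - a)"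
        using ab by linarith
      then show ?thesis using ab unfolding Op_def
        by (intro UnionI[of "{a<..<b}"] CollectI exI[of _ a] exI[of _ b] conjI refl) auto
    qed
    then have "x \<in> N k j" using xE j by (auto simp: N_def)
    then show ?case by blast
  qed
qed

text \<open>
  Where the slopes of \<open>F\<close> oscillate between \<open>p < q\<close>, the covering bound for \<open>F\<close> gives
  \<open>\<bar>F ` M\<bar> \<le> p \<bar>M\<bar>\<close>, and the one for the inverse gives \<open>\<bar>M\<bar> \<le> \<bar>F ` M\<bar> / q\<close>; so \<open>M\<close> is null.
\<close>

lemma bilipschitz_AE_differentiable:
  fixes F :: "real \<Rightarrow> real"
  assumes lo: "\<And>x y. x \<le> y \<Longrightarrow> y - x \<le> F y - F x" and up: "\<And>x y. x \<le> y \<Longrightarrow> F y - F x \<le> C * (y - x)"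
  shows "AE x in lborel. \<exists>D. (F has_real_derivative D) (at x)"
proof -
  have C: "C \<ge> 1" using lo[of 0 1] up[of 0 1] by simp
  have lip: "\<bar>F x - F y\<bar> \<le> C * \<bar>x - y\<bar>" for x y
    using lo[of x y] lo[of y x] up[of x y] up[of y x] by (cases "x \<le> y") auto
  have exp: "\<bar>x - y\<bar> \<le> \<bar>F x - F y\<bar>" for x y
    using lo[of x y] lo[of y x] by (cases "x \<le> y") auto
  have less: "F x < F y \<longleftrightarrow> x < y" for x y
    using lo[of x y] lo[of y x] by (cases "x < y") (auto simp: not_less)
  have contF: "continuous_on A F" for A
    by (rule lipschitz_on_continuous_on[of C]) (use lip C in \<open>auto intro!: lipschitz_onI simp: dist_real_def\<close>)
  have "\<exists>x. F x = y" for y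
  proof -
    define t where "t = \<bar>y - F 0\<bar>"
    have "F (- t) \<le> y" "y \<le> F t" using lo[of "-t" 0] lo[of 0 t] unfolding t_def by auto
    then show ?thesis using IVT'[of F "-t" y t] contF by (auto simp: t_def)
  qed
  then obtain G where FG: "F (G y) = y" for y by metis
  have GF: "G (F x) = x" for x using exp[of "G (F x)" x] by (simp add: FG)
  have Gless: "G y < G z \<longleftrightarrow> y < z" for y z using less[of "G y" "G z"] by (simp add: FG)
  have lipG: "\<bar>G x - G y\<bar> \<le> 1 * \<bar>x - y\<bar>" for x y using exp[of "G x" "G y"] by (simp add: FG)
  have contG: "continuous_on A G" for A
    by (rule lipschitz_on_continuous_on[of 1]) (use lipG in \<open>auto intro!: lipschitz_onI simp: dist_real_def\<close>)
  have mF[measurable]: "F \<in> borel_measurable borel" and mG[measurable]: "G \<in> borel_measurable borel"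
    using contF contG by (auto intro: borel_measurable_continuous_onI)
  \<comment> \<open>Images under \<open>F\<close> are preimages under \<open>G\<close> and
    conversely, so measuring images amounts to a push-forward by the inverse map, and images of
    Borel sets are Borel.\<close>
  have vG: "G -` A = F ` A" and vF: "F -` A = G ` A" for A
    using FG GF by (auto simp: image_iff) metis+
  have neg: "f ` A \<in> null_sets lborel"
    if "A \<in> null_sets lborel" "f ` A \<in> sets borel" "\<And>x y. \<bar>f x - f y\<bar> \<le> B * \<bar>x - y\<bar>"
    for A B and f :: "real \<Rightarrow> real"
  proof -
    have "negligible (f ` A)"
      by (rule negligible_locally_Lipschitz_image)
         (use that in \<open>auto simp: negligible_iff_null_sets null_sets_completionI intro!: exI[of _ UNIV]\<close>)
    then show ?thesis using that(2) by (simp add: negligible_iff_null_sets null_sets_completion_iff)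
  qed
  define \<nu> where "\<nu> = distr lborel borel G"
  define \<mu> where "\<mu> = distr lborel borel F"
  have \<nu>: "emeasure \<nu> A = emeasure lborel (F ` A)" "F ` A \<in> sets borel" if "A \<in> sets borel" for A
    using that measurable_sets_borel[OF mG that] by (auto simp: \<nu>_def emeasure_distr vG)
  have \<mu>: "emeasure \<mu> A = emeasure lborel (G ` A)" "G ` A \<in> sets borel" if "A \<in> sets borel" for A
    using that measurable_sets_borel[OF mF that] by (auto simp: \<mu>_def emeasure_distr vF)
  have F_Ioo: "F ` {a<..<b} = {F a<..<F b}" for a b
    unfolding vG[symmetric] using Gless GF by (auto simp: set_eq_iff) (metis)+
  have G_Ioo: "G ` {F a<..<F b} = {a<..<b}" for a b
    unfolding vF[symmetric] by (auto simp: less)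
  have ac: "absolutely_continuous lborel \<nu>" "absolutely_continuous lborel \<mu>"
    unfolding absolutely_continuous_def using neg[of _ F C] neg[of _ G 1] lip lipG \<nu> \<mu>
    by (auto simp: null_sets_def \<nu>_def \<mu>_def)
  define Lo where "Lo p n = \<Union>{{a<..<b} |a b. a < b \<and> b - a < 1 / Suc n \<and> F b - F a < p * (b - a)}" for p :: real and n :: nat
  define Hi where "Hi q n = \<Union>{{a<..<b} |a b. a < b \<and> b - a < 1 / Suc n \<and> F b - F a > q * (b - a)}" for q :: real and n :: nat
  have op: "open (Lo p n)" "open (Hi p n)" for p n unfolding Lo_def Hi_def by (auto intro!: open_Union)
  define N where "N p q j = (\<Inter>n. Lo p n) \<inter> (\<Inter>n. Hi q n) \<inter> {- real j..real j}" for p q :: real and j :: nat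
  have null: "N p q j \<in> null_sets lborel" if p: "0 < p" and pq: "p < q" for p q j
  proof -
    define M where "M = N p q j"
    have meas: "M \<in> sets borel" unfolding M_def N_def using op by auto
    have fin: "emeasure lborel M < \<infinity>"
    proof -
      have "emeasure lborel M \<le> emeasure lborel {- real j..real j}"
        by (rule emeasure_mono) (auto simp: M_def N_def)
      also have "\<dots> < \<infinity>" by simp
      finally show ?thesis .
    qed
    have 1: "emeasure lborel (F ` M) \<le> ennreal p * emeasure lborel M"
      unfolding \<nu>(1)[OF meas, symmetric]
    proof (rule Vitali_measure_le[OF _ ac(1) meas fin])
      fix x d :: real assume "x \<in> M" "d > 0"
      obtain n where n: "1 / Suc n < d" using \<open>d > 0\<close> nat_approx_posE by blast
      have "x \<in> Lo p n" using \<open>x \<in> M\<close> by (auto simp: M_def N_def)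
      then obtain a b where ab: "a < x" "x < b" "b - a < 1 / Suc n" "F b - F a < p * (b - a)"
        by (auto simp: Lo_def)
      then show "\<exists>a b. a < x \<and> x < b \<and> b - a < d \<and> emeasure \<nu> {a<..<b} \<le> ennreal (p * (b - a))"
        using n lo[of a b] by (intro exI[of _ a] exI[of _ b]) (auto simp: \<nu> F_Ioo intro!: ennreal_leI)
    qed (use p in \<open>auto simp: \<nu>_def\<close>)
    have fin': "emeasure lborel (F ` M) < \<infinity>"
      using 1 fin by (auto simp: ennreal_mult_less_top intro: le_less_trans)
    have "emeasure \<mu> (F ` M) \<le> ennreal (1 / q) * emeasure lborel (F ` M)"
    proof (rule Vitali_measure_le[OF _ ac(2) _ fin'])
      fix y d :: real assume "y \<in> F ` M" "d > 0"
      then obtain x where x: "x \<in> M" "y = F x" by auto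
      \<comment> \<open>\<open>F\<close> stretches by at most \<open>C\<close>, so an interval
        shorter than \<open>d / C\<close> has an image shorter than \<open>d\<close>.\<close>
      have "d / C > 0" using \<open>d > 0\<close> C by simp
      then obtain n where n: "1 / Suc n < d / C" using nat_approx_posE by blast
      have "x \<in> Hi q n" using x by (auto simp: M_def N_def)
      then obtain a b where ab: "a < x" "x < b" "b - a < 1 / Suc n" "F b - F a > q * (b - a)"
        by (auto simp: Hi_def)
      have "b - a < d / C" using ab n by simp
      then have "F b - F a < d" using up[of a b] ab C by (simp add: field_simps)
      moreover have "b - a \<le> 1 / q * (F b - F a)" using ab p pq by (simp add: field_simps)
      ultimately show "\<exists>a b. a < y \<and> y < b \<and> b - a < d \<and> emeasure \<mu> {a<..<b} \<le> ennreal (1 / q * (b - a))"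
        using ab x by (intro exI[of _ "F a"] exI[of _ "F b"]) (auto simp: less \<mu> G_Ioo intro!: ennreal_leI)
    qed (use p pq \<nu>[OF meas] in \<open>auto simp: \<mu>_def\<close>)
    moreover have "G ` F ` M = M" using GF by (auto simp: image_iff)
    ultimately have "emeasure lborel M \<le> ennreal (1 / q) * (ennreal p * emeasure lborel M)"
      using \<mu>[OF \<nu>(2)[OF meas]] 1 by (metis mult_left_mono order_trans zero_le)
    moreover obtain m where m: "emeasure lborel M = ennreal m" "m \<ge> 0"
      using fin by (cases "emeasure lborel M") auto
    moreover have "ennreal (1 / q) * (ennreal p * ennreal m) = ennreal (1 / q * (p * m))"
      using m(2) p pq by (subst ennreal_mult[symmetric], simp, simp, subst ennreal_mult) auto
    ultimately have "ennreal m \<le> ennreal (1 / q * (p * m))" by metis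
    then have "m \<le> 1 / q * (p * m)" using m p pq by (subst (asm) ennreal_le_iff) auto
    then have "m * (q - p) \<le> 0" using p pq by (simp add: field_simps)
    then have "m = 0" using m pq by (simp add: mult_le_0_iff)
    then show ?thesis using m meas by (auto simp: null_sets_def M_def)
  qed
  have "(\<Union>p\<in>{p\<in>\<rat>. 0 < p}. \<Union>q\<in>{q\<in>\<rat>. p < q}. \<Union>j. N p q j) \<in> null_sets lborel"
    by (intro null_sets_UN' countable_Collect countable_rat null) auto
  then show ?thesis
  proof (rule AE_I', intro subsetI)
    fix x assume nD: "x \<in> {x \<in> space lborel. \<nexists>D. (F has_real_derivative D) (at x)}"
    show "x \<in> (\<Union>p\<in>{p\<in>\<rat>. 0 < p}. \<Union>q\<in>{q\<in>\<rat>. p < q}. \<Union>j. N p q j)"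
    proof (rule ccontr)
      assume nN: "x \<notin> (\<Union>p\<in>{p\<in>\<rat>. 0 < p}. \<Union>q\<in>{q\<in>\<rat>. p < q}. \<Union>j. N p q j)"
      obtain j where j: "\<bar>x\<bar> \<le> real j" using real_arch_simple by blast
      have LH: "\<exists>n. x \<notin> Lo p n \<or> x \<notin> Hi q n" if "p \<in> \<rat>" "q \<in> \<rat>" "0 < p" "p < q" for p q
      proof -
        have "x \<notin> N p q j" using that nN by blast
        then show ?thesis using j by (auto simp: N_def)
      qed
      \<comment> \<open>The supremum of \<open>T\<close> is the lower limit of the slopes over short
        intervals around \<open>x\<close>, and thus the candidate for the derivative.\<close>
      define T where "T = {p. 0 < p \<and> (\<exists>n. x \<notin> Lo p n)}"
      have Lo: "p * (b - a) \<le> F b - F a" if "x \<notin> Lo p n" "a < x" "x < b" "b - a < 1 / Suc n" for p n a b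
      proof (rule ccontr)
        assume "\<not> p * (b - a) \<le> F b - F a"
        then have "x \<in> Lo p n" unfolding Lo_def using that
          by (intro UnionI[of "{a<..<b}"] CollectI exI[of _ a] exI[of _ b] conjI refl) auto
        then show False using that by simp
      qed
      have Hi: "F b - F a \<le> q * (b - a)" if "x \<notin> Hi q n" "a < x" "x < b" "b - a < 1 / Suc n" for q n a b
      proof (rule ccontr)
        assume "\<not> F b - F a \<le> q * (b - a)"
        then have "x \<in> Hi q n" unfolding Hi_def using that
          by (intro UnionI[of "{a<..<b}"] CollectI exI[of _ a] exI[of _ b] conjI refl) auto
        then show False using that by simp
      qed
      have "x \<notin> Lo 1 0" using lo unfolding Lo_def by (auto simp: not_less)
      then have T1: "1 \<in> T" unfolding T_def by auto
      have TC: "p \<le> C" if "p \<in> T" for p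
      proof -
        obtain n where n: "x \<notin> Lo p n" using \<open>p \<in> T\<close> by (auto simp: T_def)
        define h where "h = 1 / (3 * Suc n)"
        have h: "h > 0" "2 * h < 1 / Suc n" by (auto simp: h_def field_simps)
        have "p * (x + h - (x - h)) \<le> C * (x + h - (x - h))"
          by (rule order_trans[OF Lo[OF n] up]) (use h in auto)
        then show ?thesis using h by simp
      qed
      define c where "c = Sup T"
      have bdd: "bdd_above T" by (rule bdd_aboveI[of _ C]) (rule TC)
      have ex: "\<exists>d>0. \<forall>a b. a < x \<and> x < b \<and> b - a < d \<longrightarrow> \<bar>F b - F a - c * (b - a)\<bar> \<le> e * (b - a)"
        if e: "e > 0" for e
      proof -
        obtain p where p: "p \<in> T" "c - e < p"
          using less_cSupD[of T "c - e"] T1 e unfolding c_def by auto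
        then obtain n where n: "x \<notin> Lo p n" by (auto simp: T_def)
        \<comment> \<open>Two rationals are needed: \<open>q1 > c\<close> is outside
          \<open>T\<close>, so \<open>x\<close> lies in every \<open>Lo q1 n\<close>; as
          \<open>x\<close> avoids all the null sets, it must leave some \<open>Hi q2 m\<close>,
          which bounds the slopes above by \<open>q2 < c + e\<close>.\<close>
        obtain q1 where q1: "q1 \<in> \<rat>" "c < q1" "q1 < c + e" using Rats_dense_in_real[of c "c + e"] e by auto
        obtain q2 where q2: "q2 \<in> \<rat>" "q1 < q2" "q2 < c + e" using Rats_dense_in_real[of q1 "c + e"] q1 by auto
        have "1 \<le> c" unfolding c_def by (rule cSup_upper[OF T1 bdd])
        moreover have "q1 \<notin> T" using q1 cSup_upper[OF _ bdd, of q1] unfolding c_def by auto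
        ultimately obtain m where m: "x \<notin> Hi q2 m" using LH[of q1 q2] q1 q2 by (auto simp: T_def)
        show ?thesis
        proof (intro exI[of _ "min (1 / Suc n) (1 / Suc m)"] conjI allI impI)
          fix a b assume ab: "a < x \<and> x < b \<and> b - a < min (1 / Suc n) (1 / Suc m)"
          have "p * (b - a) \<le> F b - F a" "F b - F a \<le> q2 * (b - a)"
            using Lo[OF n, of a b] Hi[OF m, of a b] ab by auto
          moreover have "(c - e) * (b - a) \<le> p * (b - a)" "q2 * (b - a) \<le> (c + e) * (b - a)"
            using p q2 ab by (auto intro!: mult_right_mono)
          ultimately show "\<bar>F b - F a - c * (b - a)\<bar> \<le> e * (b - a)" by (simp add: algebra_simps abs_le_iff)
        qed auto
      qed
      have contx: "isCont F z" for z using contF[of UNIV] by (simp add: continuous_on_eq_continuous_at)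
      have "\<exists>d>0. \<forall>h. h \<noteq> 0 \<and> \<bar>h\<bar> < d \<longrightarrow> \<bar>(F (x + h) - F x) / h - c\<bar> < e" if e: "e > 0" for e
      proof -
        obtain d where d: "d > 0" "\<And>a b. a < x \<Longrightarrow> x < b \<Longrightarrow> b - a < d \<Longrightarrow> \<bar>F b - F a - c * (b - a)\<bar> \<le> e/2 * (b - a)"
          using ex[of "e/2"] e by auto
        \<comment> \<open>So far \<open>x\<close> is interior to the intervals. Moving the ends
          outward by \<open>\<eta>\<close> and letting \<open>\<eta>\<close> tend to 0 admits
          \<open>x\<close> as an end, as difference quotients require.\<close>
        have ineq: "\<bar>F b - F a - c * (b - a)\<bar> \<le> e/2 * (b - a)" if ab: "a \<le> x" "x \<le> b" "b - a < d" "a < b" for a b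
        proof -
          have "((\<lambda>\<eta>. \<bar>F (b + \<eta>) - F (a - \<eta>) - c * (b - a + 2 * \<eta>)\<bar> - e/2 * (b - a + 2 * \<eta>)) \<longlongrightarrow>
             \<bar>F (b + 0) - F (a - 0) - c * (b - a + 2 * 0)\<bar> - e/2 * (b - a + 2 * 0)) (at_right 0)"
            by (intro tendsto_intros isCont_tendsto_compose[OF contx])
          moreover have "eventually (\<lambda>\<eta>. \<bar>F (b + \<eta>) - F (a - \<eta>) - c * (b - a + 2 * \<eta>)\<bar> - e/2 * (b - a + 2 * \<eta>) \<le> 0) (at_right 0)"
          proof -
            have "eventually (\<lambda>\<eta>. \<eta> \<in> {0<..<(d - (b - a)) / 2}) (at_right (0::real))"
              by (rule eventually_at_right_real) (use ab in auto)
            then show ?thesis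
            proof eventually_elim
              case (elim \<eta>)
              then show ?case using d(2)[of "a - \<eta>" "b + \<eta>"] ab by (simp add: algebra_simps)
            qed
          qed
          ultimately show ?thesis using tendsto_upperbound by fastforce
        qed
        show ?thesis
        proof (intro exI[of _ d] conjI allI impI d)
          fix h assume h: "h \<noteq> 0 \<and> \<bar>h\<bar> < d"
          have "\<bar>F (x + h) - F x - c * h\<bar> \<le> e/2 * \<bar>h\<bar>"
            using ineq[of x "x + h"] ineq[of "x + h" x] h
            by (cases "h > 0") (auto simp: abs_minus_commute algebra_simps)
          then have "\<bar>(F (x + h) - F x - c * h) / h\<bar> \<le> e / 2" using h by (simp add: abs_divide pos_divide_le_eq)
          moreover have "(F (x + h) - F x - c * h) / h = (F (x + h) - F x) / h - c" using h by (simp add: diff_divide_distrib)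
          ultimately show "\<bar>(F (x + h) - F x) / h - c\<bar> < e" using e by auto
        qed
      qed
      then have "(F has_real_derivative c) (at x)"
        unfolding DERIV_def LIM_def by (simp add: dist_real_def)
      then show False using nD by auto
    qed
  qed
qed

text \<open>Adding \<open>(L + 1) * x\<close> moves all slopes into \<open>[1, 2 * L + 1]\<close>,
  where the bilipschitz case applies; the added term is smooth.\<close>

lemma lipschitz_AE_differentiable:
  fixes f :: "real \<Rightarrow> real"
  assumes "L-lipschitz_on UNIV f"
  shows "AE x in lborel. \<exists>D. (f has_real_derivative D) (at x)"
proof -
  have L: "\<bar>f x - f y\<bar> \<le> L * \<bar>x - y\<bar>" for x y using lipschitz_onD[OF assms, of x y] by (simp add: dist_real_def)
  have "AE x in lborel. \<exists>D. ((\<lambda>x. f x + (L + 1) * x) has_real_derivative D) (at x)"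
  proof (rule bilipschitz_AE_differentiable[of _ "2 * L + 1"])
    fix x y :: real assume "x \<le> y"
    then show "y - x \<le> f y + (L + 1) * y - (f x + (L + 1) * x)"
      "f y + (L + 1) * y - (f x + (L + 1) * x) \<le> (2 * L + 1) * (y - x)"
      using L[of x y] by (auto simp: algebra_simps abs_if split: if_splits)
  qed
  then show ?thesis
  proof eventually_elim
    case (elim x)
    then obtain D where D: "((\<lambda>x. f x + (L + 1) * x) has_real_derivative D) (at x)" by blast
    have "((\<lambda>x. f x + (L + 1) * x - (L + 1) * x) has_real_derivative D - (L + 1)) (at x)"
      by (rule D[THEN DERIV_diff]) (auto intro!: derivative_eq_intros)
    then show ?case by auto
  qed
qed

section \<open>Interpolation over the gaps of a closed set\<close>

definition gap_lo :: "real set \<Rightarrow> real \<Rightarrow> real" where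
  "gap_lo C x = Sup (C \<inter> {..x})"

definition gap_hi :: "real set \<Rightarrow> real \<Rightarrow> real" where
  "gap_hi C x = Inf (C \<inter> {x..})"

text \<open>At points of a closed \<open>C\<close> both gap ends equal \<open>x\<close>; the
  quotient is then 0 / 0 = 0, and the formula returns \<open>\<phi> x\<close>.\<close>

definition gap_interp :: "real set \<Rightarrow> (real \<Rightarrow> real) \<Rightarrow> real \<Rightarrow> real" where
  "gap_interp C \<phi> x = \<phi> (gap_lo C x) +
     (x - gap_lo C x) / (gap_hi C x - gap_lo C x) * (\<phi> (gap_hi C x) - \<phi> (gap_lo C x))"

text \<open>Unboundedness in both directions makes the sets under \<open>Sup\<close> and
  \<open>Inf\<close> in the gap ends nonempty, so each point has neighbours in \<open>C\<close> on
  both sides.\<close>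

locale two_sided_closed =
  fixes C :: "real set"
  assumes closed_C: "closed C" and below: "\<And>x. \<exists>c\<in>C. c \<le> x" and above: "\<And>x. \<exists>c\<in>C. x \<le> c"
begin

lemma gap_lo: "gap_lo C x \<in> C" "gap_lo C x \<le> x"
proof -
  have "gap_lo C x \<in> C \<inter> {..x}" unfolding gap_lo_def
    by (rule closed_contains_Sup) (use closed_C below in \<open>auto intro: bdd_aboveI[of _ x] closed_Int\<close>)
  then show "gap_lo C x \<in> C" "gap_lo C x \<le> x" by auto
qed

lemma gap_hi: "gap_hi C x \<in> C" "x \<le> gap_hi C x"
proof -
  have "gap_hi C x \<in> C \<inter> {x..}" unfolding gap_hi_def
    by (rule closed_contains_Inf) (use closed_C above in \<open>auto intro: bdd_belowI[of _ x] closed_Int\<close>)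
  then show "gap_hi C x \<in> C" "x \<le> gap_hi C x" by auto
qed

lemma le_gap_lo: "c \<in> C \<Longrightarrow> c \<le> x \<Longrightarrow> c \<le> gap_lo C x"
  unfolding gap_lo_def by (rule cSup_upper) (auto intro: bdd_aboveI[of _ x])

lemma gap_hi_le: "c \<in> C \<Longrightarrow> x \<le> c \<Longrightarrow> gap_hi C x \<le> c"
  unfolding gap_hi_def by (rule cInf_lower) (auto intro: bdd_belowI[of _ x])

lemma gap_mem: "x \<in> C \<Longrightarrow> gap_lo C x = x" "x \<in> C \<Longrightarrow> gap_hi C x = x"
  using gap_lo[of x] gap_hi[of x] le_gap_lo[of x x] gap_hi_le[of x x] by auto

lemma gap_interp_mem: "x \<in> C \<Longrightarrow> gap_interp C \<phi> x = \<phi> x"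
  by (simp add: gap_interp_def gap_mem)

text \<open>One and the same weight \<open>t\<close> represents \<open>x\<close> and all
  interpolated values, so that concavity of a modulus can be applied to the distances from the gap
  ends.\<close>

lemma gap_interp_convex:
  "\<exists>t. 0 \<le> t \<and> t \<le> 1 \<and> x = (1 - t) * gap_lo C x + t * gap_hi C x \<and>
    (\<forall>\<phi>. gap_interp C \<phi> x = (1 - t) * \<phi> (gap_lo C x) + t * \<phi> (gap_hi C x))"
proof (cases "gap_hi C x = gap_lo C x")
  case True
  then have "x = gap_lo C x" using gap_lo[of x] gap_hi[of x] by simp
  then show ?thesis using True by (intro exI[of _ 0]) (simp add: gap_interp_def)
next
  case False
  then have pos: "gap_hi C x - gap_lo C x > 0" using gap_lo[of x] gap_hi[of x] by simp
  define t where "t = (x - gap_lo C x) / (gap_hi C x - gap_lo C x)"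
  have "t * (gap_hi C x - gap_lo C x) = x - gap_lo C x" using pos by (simp add: t_def)
  then have "x = (1 - t) * gap_lo C x + t * gap_hi C x" by (simp add: algebra_simps)
  moreover have "0 \<le> t" "t \<le> 1" using pos gap_lo[of x] gap_hi[of x] by (auto simp: t_def)
  moreover have "gap_interp C \<phi> x = (1 - t) * \<phi> (gap_lo C x) + t * \<phi> (gap_hi C x)" for \<phi>
    by (simp add: gap_interp_def t_def[symmetric] algebra_simps)
  ultimately show ?thesis by blast
qed

text \<open>For points in separate gaps, concavity is used twice, first averaging over the gap ends
  around \<open>x\<close>, then over those around \<open>y\<close>; within one gap the interpolation
  is a chord. The set \<open>S\<close> only has to contain the four gap ends, which lets bounds
  known on \<open>K_set\<close> act at points outside it.\<close>

lemma gap_interp_modulus: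
  assumes conc: "concave_on {0..} \<omega>" and om0: "\<omega> 0 \<ge> 0"
    and mod: "\<And>u v. u \<in> S \<Longrightarrow> v \<in> S \<Longrightarrow> \<bar>\<phi> u - \<phi> v\<bar> \<le> \<omega> \<bar>u - v\<bar>"
    and S: "gap_lo C x \<in> S" "gap_hi C x \<in> S" "gap_lo C y \<in> S" "gap_hi C y \<in> S"
  shows "\<bar>gap_interp C \<phi> x - gap_interp C \<phi> y\<bar> \<le> \<omega> \<bar>x - y\<bar>"
  using S
proof (induction x y rule: linorder_wlog)
  case (sym a b)
  then show ?case by (simp add: abs_minus_commute)
next
  case (le x y)
  have conv: "(1 - t) * \<omega> u + t * \<omega> v \<le> \<omega> ((1 - t) * u + t * v)"
    if "0 \<le> t" "t \<le> 1" "0 \<le> u" "0 \<le> v" for t u v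
    using concave_onD[OF conc, of t u v] that by simp
  show ?case
  proof (cases "gap_hi C x \<le> gap_lo C y")
    case True
    obtain t where t: "0 \<le> t" "t \<le> 1" "x = (1 - t) * gap_lo C x + t * gap_hi C x"
      "\<And>\<phi>. gap_interp C \<phi> x = (1 - t) * \<phi> (gap_lo C x) + t * \<phi> (gap_hi C x)" using gap_interp_convex[of x] by metis
    obtain s where s: "0 \<le> s" "s \<le> 1" "y = (1 - s) * gap_lo C y + s * gap_hi C y"
      "\<And>\<phi>. gap_interp C \<phi> y = (1 - s) * \<phi> (gap_lo C y) + s * \<phi> (gap_hi C y)" using gap_interp_convex[of y] by metis
    have step: "\<bar>gap_interp C \<phi> x - \<phi> z\<bar> \<le> \<omega> (z - x)" if z: "z \<in> S" "gap_hi C x \<le> z" for z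
    proof -
      have "gap_interp C \<phi> x - \<phi> z = (1 - t) * (\<phi> (gap_lo C x) - \<phi> z) + t * (\<phi> (gap_hi C x) - \<phi> z)"
        unfolding t(4) by (simp add: algebra_simps)
      then have "\<bar>gap_interp C \<phi> x - \<phi> z\<bar> \<le> \<bar>(1 - t) * (\<phi> (gap_lo C x) - \<phi> z)\<bar> + \<bar>t * (\<phi> (gap_hi C x) - \<phi> z)\<bar>"
        by linarith
      also have "\<dots> = (1 - t) * \<bar>\<phi> (gap_lo C x) - \<phi> z\<bar> + t * \<bar>\<phi> (gap_hi C x) - \<phi> z\<bar>"
        using t by (simp add: abs_mult)
      also have "\<dots> \<le> (1 - t) * \<omega> (z - gap_lo C x) + t * \<omega> (z - gap_hi C x)"
        using mod[of "gap_lo C x" z] mod[of "gap_hi C x" z] le(2-5) z t gap_lo(2)[of x] gap_hi(2)[of x]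
        by (intro add_mono mult_left_mono) auto
      also have "\<dots> \<le> \<omega> ((1 - t) * (z - gap_lo C x) + t * (z - gap_hi C x))"
        by (rule conv) (use t z gap_lo(2)[of x] gap_hi(2)[of x] in auto)
      also have "(1 - t) * (z - gap_lo C x) + t * (z - gap_hi C x) = z - x"
        using t(3) by (simp add: algebra_simps)
      finally show ?thesis .
    qed
    have "gap_interp C \<phi> x - gap_interp C \<phi> y =
        (1 - s) * (gap_interp C \<phi> x - \<phi> (gap_lo C y)) + s * (gap_interp C \<phi> x - \<phi> (gap_hi C y))"
      unfolding s(4) by (simp add: algebra_simps)
    then have "\<bar>gap_interp C \<phi> x - gap_interp C \<phi> y\<bar> \<le>
        \<bar>(1 - s) * (gap_interp C \<phi> x - \<phi> (gap_lo C y))\<bar> + \<bar>s * (gap_interp C \<phi> x - \<phi> (gap_hi C y))\<bar>"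
      by linarith
    also have "\<dots> = (1 - s) * \<bar>gap_interp C \<phi> x - \<phi> (gap_lo C y)\<bar> + s * \<bar>gap_interp C \<phi> x - \<phi> (gap_hi C y)\<bar>"
      using s by (simp add: abs_mult)
    also have "\<dots> \<le> (1 - s) * \<omega> (gap_lo C y - x) + s * \<omega> (gap_hi C y - x)"
      using step le(2-5) s True gap_lo(2)[of y] gap_hi(2)[of y]
      by (intro add_mono mult_left_mono) auto
    also have "\<dots> \<le> \<omega> ((1 - s) * (gap_lo C y - x) + s * (gap_hi C y - x))"
      by (rule conv) (use s True gap_hi(2)[of x] gap_lo(2)[of y] gap_hi(2)[of y] in auto)
    also have "(1 - s) * (gap_lo C y - x) + s * (gap_hi C y - x) = \<bar>x - y\<bar>"
      using s(3) le(1) by (simp add: algebra_simps)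
    finally show ?thesis .
  next
    case False
    \<comment> \<open>The gaps overlap, so they coincide.\<close>
    have "gap_lo C y < x" using False gap_hi_le[OF gap_lo(1)[of y], of x] by linarith
    then have lo: "gap_lo C x = gap_lo C y"
      using le_gap_lo[OF gap_lo(1)[of y], of x] le_gap_lo[OF gap_lo(1)[of x], of y] gap_lo(2)[of x] le(1) by linarith
    have "gap_hi C x > y" using False le_gap_lo[OF gap_hi(1)[of x], of y] by linarith
    then have hi: "gap_hi C x = gap_hi C y"
      using gap_hi_le[OF gap_hi(1)[of y], of x] gap_hi_le[OF gap_hi(1)[of x], of y] gap_hi(2)[of y] le(1) by linarith
    define a b where "a = gap_lo C y" and "b = gap_hi C y"
    have ab: "a \<le> x" "x \<le> y" "y \<le> b" "a < b"
      using gap_lo[of x] gap_hi[of y] lo hi le(1) False by (auto simp: a_def b_def)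
    define r where "r = (y - x) / (b - a)"
    have r: "0 \<le> r" "r \<le> 1" using ab by (auto simp: r_def)
    have rb: "r * (b - a) = y - x" using ab by (simp add: r_def)
    have "gap_interp C \<phi> x - gap_interp C \<phi> y = - r * (\<phi> b - \<phi> a)"
      unfolding gap_interp_def lo hi a_def[symmetric] b_def[symmetric] r_def using ab
      by (simp add: diff_divide_distrib algebra_simps)
    then have "\<bar>gap_interp C \<phi> x - gap_interp C \<phi> y\<bar> = r * \<bar>\<phi> b - \<phi> a\<bar>" using r by (simp add: abs_mult)
    also have "\<dots> \<le> r * \<omega> (b - a)"
      using mod[of b a] le(4,5) ab r by (intro mult_left_mono) (auto simp: a_def b_def)
    \<comment> \<open>The nonnegative term at 0 completes a convex combination of the values at 0
      and \<open>b - a\<close>.\<close>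
    also have "\<dots> \<le> (1 - r) * \<omega> 0 + r * \<omega> (b - a)" using r om0 by simp
    also have "\<dots> \<le> \<omega> ((1 - r) * 0 + r * (b - a))" by (rule conv) (use r ab in auto)
    also have "\<dots> = \<omega> \<bar>x - y\<bar>" using rb ab by simp
    finally show ?thesis .
  qed
qed

end

text \<open>The graph lies below its tangent at each \<open>m > 0\<close>, by Young's inequality
  u^\<alpha> m^(1-\<alpha>) \<le> \<alpha> u + (1-\<alpha>) m. At the weighted mean \<open>m\<close>
  of \<open>x\<close> and \<open>y\<close> the linear terms of the two tangent bounds
  cancel.\<close>

lemma concave_on_powr:
  fixes \<alpha> H :: real
  assumes "0 < \<alpha>" "\<alpha> < 1" "0 \<le> H"
  shows "concave_on {0..} (\<lambda>t. H * t powr \<alpha>)"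
proof -
  have tangent: "u powr \<alpha> \<le> m powr \<alpha> + \<alpha> * m powr (\<alpha> - 1) * (u - m)" if "u \<ge> 0" "m > 0" for u m
  proof (cases "u = 0")
    case True
    have "\<alpha> * m powr (\<alpha> - 1) * m = \<alpha> * m powr \<alpha>" using that by (simp add: powr_diff)
    also have "\<dots> \<le> m powr \<alpha>" using assms by (simp add: mult_left_le_one_le)
    finally show ?thesis using True assms by (simp add: algebra_simps)
  next
    case False
    have "u powr \<alpha> = m powr (\<alpha> - 1) * (u powr \<alpha> * m powr (1 - \<alpha>))"
      using that by (simp add: powr_diff field_simps)
    also have "\<dots> \<le> m powr (\<alpha> - 1) * (\<alpha> * u + (1 - \<alpha>) * m)"
      using Youngs_inequality_0[of \<alpha> "1 - \<alpha>" u m] assms that False by (intro mult_left_mono) auto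
    also have "\<dots> = m powr \<alpha> + \<alpha> * m powr (\<alpha> - 1) * (u - m)"
      using that by (simp add: powr_diff field_simps)
    finally show ?thesis .
  qed
  have "concave_on {0..} (\<lambda>t. t powr \<alpha>)"
  proof (rule concave_on_linorderI)
    fix t x y :: real assume t: "0 < t" "t < 1" and xy: "x \<in> {0..}" "y \<in> {0..}"
    define m where "m = (1 - t) * x + t * y"
    show "(1 - t) * x powr \<alpha> + t * y powr \<alpha> \<le> ((1 - t) *\<^sub>R x + t *\<^sub>R y) powr \<alpha>"
    proof (cases "m = 0")
      case True
      then have "x = 0" "y = 0" using t xy by (auto simp: m_def add_nonneg_eq_0_iff)
      then show ?thesis by simp
    next
      case False
      then have m: "m > 0" using t xy by (simp add: m_def less_le)
      have "(1 - t) * x powr \<alpha> + t * y powr \<alpha> \<le>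
          (1 - t) * (m powr \<alpha> + \<alpha> * m powr (\<alpha> - 1) * (x - m)) + t * (m powr \<alpha> + \<alpha> * m powr (\<alpha> - 1) * (y - m))"
        using tangent[of x m] tangent[of y m] m t xy by (intro add_mono mult_left_mono) auto
      also have "\<dots> = m powr \<alpha> + \<alpha> * m powr (\<alpha> - 1) * ((1 - t) * x + t * y - m)"
        by (simp add: algebra_simps)
      finally show ?thesis by (simp add: m_def)
    qed
  qed simp
  then show ?thesis using assms by (intro concave_on_cmul)
qed

lemma concave_on_linear: "concave_on {0..} (\<lambda>t::real. L * t)"
  by (rule concave_on_linorderI) (auto simp: algebra_simps)

text \<open>A small derivative alone does not give a small function on the whole line; bounded
  support does, since the primitive vanishing at \<open>a\<close> is constant on either side of
  \<open>{a..b}\<close>. This keeps the constructed functions bounded and close in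
  \<open>C1b_dist\<close>.\<close>

lemma antiderivative_bounded_support:
  fixes u :: "real \<Rightarrow> real"
  assumes cont: "continuous_on UNIV u" and ab: "a \<le> b"
    and supp: "\<And>x. x \<notin> {a..b} \<Longrightarrow> u x = 0" and bd: "\<And>x. \<bar>u x\<bar> \<le> \<eta>"
  shows "\<exists>D. (\<forall>x. (D has_real_derivative u x) (at x)) \<and> (\<forall>x. \<bar>D x\<bar> \<le> \<eta> * (b - a))"
proof -
  have "\<exists>F. \<forall>x::real. - \<infinity> < ereal x \<longrightarrow> ereal x < \<infinity> \<longrightarrow> (F has_vector_derivative u x) (at x)"
    by (rule einterval_antiderivative) (use cont in \<open>auto simp: continuous_on_eq_continuous_at\<close>)
  then obtain F where F: "\<And>x. (F has_real_derivative u x) (at x)"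
    by (auto simp: has_real_derivative_iff_has_vector_derivative)
  have bound: "\<bar>F y - F x\<bar> \<le> c * (y - x)" if xy: "x \<le> y" and ub: "\<And>z. x < z \<Longrightarrow> z < y \<Longrightarrow> \<bar>u z\<bar> \<le> c" for x y c
  proof (cases "x = y")
    case False
    then obtain z where z: "x < z" "z < y" "F y - F x = (y - x) * u z"
      using MVT2[of x y F u, OF _ F] xy False by auto
    then show ?thesis using ub[OF z(1,2)] xy by (simp add: abs_mult mult.commute mult_left_mono)
  qed simp
  have "\<bar>F x - F a\<bar> \<le> \<eta> * (b - a)" for x
  proof -
    have \<eta>: "\<eta> \<ge> 0" using bd[of 0] by linarith
    consider "x \<le> a" | "a \<le> x" "x \<le> b" | "b \<le> x" by linarith
    then show ?thesis
    proof cases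
      case 1
      then have "\<bar>F a - F x\<bar> \<le> 0 * (a - x)" by (intro bound) (auto simp: supp)
      then show ?thesis using \<eta> ab by (auto simp: abs_minus_commute)
    next
      case 2
      then have "\<bar>F x - F a\<bar> \<le> \<eta> * (x - a)" by (intro bound) (auto simp: bd)
      also have "\<dots> \<le> \<eta> * (b - a)" using 2 \<eta> by (intro mult_left_mono) auto
      finally show ?thesis .
    next
      case 3
      then have "\<bar>F x - F b\<bar> \<le> 0 * (x - b)" by (intro bound) (auto simp: supp)
      moreover have "\<bar>F b - F a\<bar> \<le> \<eta> * (b - a)" using ab by (intro bound) (auto simp: bd)
      ultimately show ?thesis by simp
    qed
  qed
  moreover have "((\<lambda>x. F x - F a) has_real_derivative u x) (at x)" for x
    using F by (auto intro!: derivative_eq_intros)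
  ultimately show ?thesis by blast
qed

section \<open>The function space and the exceptional sets\<close>

lemma C1b_I:
  assumes f: "\<And>x. (f has_real_derivative f' x) (at x)" and cont: "continuous_on UNIV f'"
    and bd: "\<And>x. \<bar>f x\<bar> \<le> A" "\<And>x. \<bar>f' x\<bar> \<le> B"
  shows "f \<in> C1b" "deriv f = f'"
proof -
  show d: "deriv f = f'" using f by (auto intro!: ext DERIV_imp_deriv)
  show "f \<in> C1b" unfolding C1b_def C1_differentiable_on_def
    using f cont bd by (auto simp: d bounded_iff has_real_derivative_iff_has_vector_derivative)
qed

lemma C1b_continuous:
  assumes "f \<in> C1b"
  shows "continuous_on A f" "continuous_on A (deriv f)"
proof -
  show "continuous_on A f"
    using C1b_DERIV[OF assms] by (meson DERIV_isCont continuous_at_imp_continuous_on)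
  obtain D where D: "\<And>x. (f has_vector_derivative D x) (at x)" "continuous_on UNIV D"
    using assms by (auto simp: C1b_def C1_differentiable_on_def)
  have "deriv f = D"
    using D(1) by (auto intro!: ext DERIV_imp_deriv simp: has_real_derivative_iff_has_vector_derivative)
  then show "continuous_on A (deriv f)" using D(2) continuous_on_subset by blast
qed

lemma C1b_dist_eq:
  assumes f: "f \<in> C1b" and g: "g \<in> C1b"
  shows "C1b_dist f g = (SUP x. \<bar>f x - g x\<bar>) + (SUP x. \<bar>deriv f x - deriv g x\<bar>)"
proof -
  have "deriv (\<lambda>x. f x - g x) = (\<lambda>x. deriv f x - deriv g x)"
    by (rule ext, rule DERIV_imp_deriv) (intro DERIV_diff C1b_DERIV f g)
  then show ?thesis using f g by (simp add: C1b_dist_def C1b_norm_def)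
qed

lemma C1b_dist_le:
  assumes "f \<in> C1b" "g \<in> C1b" "\<And>x. \<bar>f x - g x\<bar> \<le> a" "\<And>x. \<bar>deriv f x - deriv g x\<bar> \<le> b"
  shows "C1b_dist f g \<le> a + b"
  unfolding C1b_dist_eq[OF assms(1,2)] by (intro add_mono cSUP_least assms) auto

lemma le_C1b_dist:
  assumes f: "f \<in> C1b" and g: "g \<in> C1b"
  shows "\<bar>f x - g x\<bar> \<le> C1b_dist f g" "\<bar>deriv f x - deriv g x\<bar> \<le> C1b_dist f g"
proof -
  obtain B C where 1: "\<And>x. \<bar>f x\<bar> \<le> B" "\<And>x. \<bar>deriv f x\<bar> \<le> C" using C1b_bdd[OF f] by blast
  obtain B' C' where 2: "\<And>x. \<bar>g x\<bar> \<le> B'" "\<And>x. \<bar>deriv g x\<bar> \<le> C'" using C1b_bdd[OF g] by blast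
  have b: "\<bar>f y - g y\<bar> \<le> B + B'" "\<bar>deriv f y - deriv g y\<bar> \<le> C + C'" for y
    using 1[of y] 2[of y] by linarith+
  have bdd: "bdd_above (range (\<lambda>y. \<bar>f y - g y\<bar>))" "bdd_above (range (\<lambda>y. \<bar>deriv f y - deriv g y\<bar>))"
    by (rule bdd_aboveI2[OF b(1)], rule bdd_aboveI2[OF b(2)])
  have up: "\<bar>f y - g y\<bar> \<le> (SUP x. \<bar>f x - g x\<bar>)" "\<bar>deriv f y - deriv g y\<bar> \<le> (SUP x. \<bar>deriv f x - deriv g x\<bar>)" for y
    by (rule cSUP_upper[OF UNIV_I bdd(1)], rule cSUP_upper[OF UNIV_I bdd(2)])
  show "\<bar>f x - g x\<bar> \<le> C1b_dist f g" "\<bar>deriv f x - deriv g x\<bar> \<le> C1b_dist f g"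
    unfolding C1b_dist_eq[OF f g] using up(1)[of x] up(2)[of x] by linarith+
qed

lemma X_space_I:
  assumes f: "\<And>x. (f has_real_derivative f' x) (at x)" and cont: "continuous_on UNIV f'"
    and bd: "\<And>x. \<bar>f x\<bar> \<le> A" "\<And>x. \<bar>f' x\<bar> \<le> B"
    and "\<And>x. 0 \<le> f' x" "\<And>x y. \<bar>f' x - f' y\<bar> \<le> H * \<bar>x - y\<bar> powr \<alpha>"
    and "\<And>n x y. n \<ge> 1 \<Longrightarrow> x \<in> K_set \<beta> n \<Longrightarrow> y \<in> K_set \<beta> n \<Longrightarrow> \<bar>f' x - f' y\<bar> \<le> \<Lambda> n * \<bar>x - y\<bar>"
  shows "f \<in> X_space \<alpha> \<beta> H \<Lambda>" "deriv f = f'"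
  using C1b_I[OF f cont bd] assms(5-) by (auto simp: X_space_def)

lemma X_space_D:
  assumes "f \<in> X_space \<alpha> \<beta> H \<Lambda>"
  shows "f \<in> C1b" "0 \<le> deriv f x" "\<bar>deriv f x - deriv f y\<bar> \<le> H * \<bar>x - y\<bar> powr \<alpha>"
    "n \<ge> 1 \<Longrightarrow> x \<in> K_set \<beta> n \<Longrightarrow> y \<in> K_set \<beta> n \<Longrightarrow> \<bar>deriv f x - deriv f y\<bar> \<le> \<Lambda> n * \<bar>x - y\<bar>"
  using assms by (auto simp: X_space_def)

lemma abs_convex_combination_le:
  fixes a b A B t :: real
  assumes "0 \<le> t" "t \<le> 1" "\<bar>a\<bar> \<le> A" "\<bar>b\<bar> \<le> A"
  shows "\<bar>(1 - t) * a + t * b\<bar> \<le> A"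
proof -
  have "\<bar>(1 - t) * a + t * b\<bar> \<le> (1 - t) * \<bar>a\<bar> + t * \<bar>b\<bar>"
    using assms abs_triangle_ineq[of "(1 - t) * a" "t * b"] by (simp add: abs_mult)
  also have "\<dots> \<le> (1 - t) * A + t * A" using assms by (intro add_mono mult_left_mono) auto
  finally show ?thesis by (simp add: algebra_simps)
qed

text \<open>All constraints are convex in the derivative and keep their constants, whereas a plain
  sum could violate the bound with \<open>H\<close> or with some \<open>\<Lambda> n\<close>.\<close>

lemma X_space_convex:
  assumes f: "f \<in> X_space \<alpha> \<beta> H \<Lambda>" and g: "g \<in> X_space \<alpha> \<beta> H \<Lambda>" and t: "0 \<le> t" "t \<le> 1"
  shows "(\<lambda>x. (1 - t) * f x + t * g x) \<in> X_space \<alpha> \<beta> H \<Lambda>"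
    "deriv (\<lambda>x. (1 - t) * f x + t * g x) = (\<lambda>x. (1 - t) * deriv f x + t * deriv g x)"
proof -
  note fX = X_space_D[OF f] and gX = X_space_D[OF g]
  obtain B C where 1: "\<And>x. \<bar>f x\<bar> \<le> B" "\<And>x. \<bar>deriv f x\<bar> \<le> C" using C1b_bdd[OF fX(1)] by blast
  obtain B' C' where 2: "\<And>x. \<bar>g x\<bar> \<le> B'" "\<And>x. \<bar>deriv g x\<bar> \<le> C'" using C1b_bdd[OF gX(1)] by blast
  have diff: "(1 - t) * u x + t * v x - ((1 - t) * u y + t * v y) = (1 - t) * (u x - u y) + t * (v x - v y)"
    for u v :: "real \<Rightarrow> real" and x y by (simp add: algebra_simps)
  have bd: "\<bar>(1 - t) * f x + t * g x\<bar> \<le> max B B'" "\<bar>(1 - t) * deriv f x + t * deriv g x\<bar> \<le> max C C'" for x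
    using 1[of x] 2[of x] by (auto intro!: abs_convex_combination_le t)
  have *: "((\<lambda>x. (1 - t) * f x + t * g x) has_real_derivative (1 - t) * deriv f x + t * deriv g x) (at x)" for x
    by (auto intro!: derivative_eq_intros C1b_DERIV fX gX)
  have **: "continuous_on UNIV (\<lambda>x. (1 - t) * deriv f x + t * deriv g x)"
    by (intro continuous_intros C1b_continuous fX gX)
  note XI = X_space_I[where f = "\<lambda>x. (1 - t) * f x + t * g x", OF * ** bd, of H \<alpha> \<beta> \<Lambda>, unfolded diff]
  show "(\<lambda>x. (1 - t) * f x + t * g x) \<in> X_space \<alpha> \<beta> H \<Lambda>"
    by (rule XI(1)) (use fX gX t in \<open>auto intro!: abs_convex_combination_le\<close>)
  show "deriv (\<lambda>x. (1 - t) * f x + t * g x) = (\<lambda>x. (1 - t) * deriv f x + t * deriv g x)"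
    by (rule XI(2)) (use fX gX t in \<open>auto intro!: abs_convex_combination_le\<close>)
qed

section \<open>The dyadic neighbourhoods: periodicity, measure, and abundance of the sets
  \<open>K_set\<close>\<close>

lemma open_U_set: "open (U_set \<beta> n)"
  unfolding U_set_def Int_nj_def by auto

lemma closed_K_set: "closed (K_set \<beta> n)"
  unfolding K_set_def U_hat_def by (auto intro!: closed_Diff open_U_set)

lemma K_set_mono: "m \<le> n \<Longrightarrow> K_set \<beta> m \<subseteq> K_set \<beta> n"
  unfolding K_set_def U_hat_def by force

text \<open>An integer \<open>m\<close> equals \<open>m * 2 ^ n / 2 ^ n\<close>, so translation by
  it permutes the centres of every level. Through \<open>K_set_add_int\<close> a nonempty
  \<open>K_set\<close> is unbounded in both directions.\<close>

lemma U_set_add_int: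
  assumes "x + of_int m \<in> U_set \<beta> n"
  shows "x \<in> U_set \<beta> n"
proof -
  obtain j where j: "x + of_int m \<in> Int_nj \<beta> n j" using assms by (auto simp: U_set_def)
  have "real_of_int (j - m * 2 ^ n) / 2 ^ n = of_int j / 2 ^ n - of_int m"
    by (simp add: diff_divide_distrib)
  then have "x \<in> Int_nj \<beta> n (j - m * 2 ^ n)" using j unfolding Int_nj_def by auto
  then show ?thesis by (auto simp: U_set_def)
qed

lemma K_set_add_int: "x \<in> K_set \<beta> n \<Longrightarrow> x + of_int m \<in> K_set \<beta> n"
  unfolding K_set_def U_hat_def using U_set_add_int by blast

text \<open>At most 2 (N + 2) 2^n intervals of length 2^(1 - \<beta> n) are needed in the window;
  the product is a geometric sequence, decaying once \<beta> > 1.\<close>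

lemma emeasure_U_set_le:
  fixes N :: nat
  assumes \<beta>: "\<beta> > 0"
  shows "emeasure lborel (U_set \<beta> n \<inter> {- real N..real N}) \<le> ennreal (4 * (real N + 2) * (2 powr (1 - \<beta>)) ^ n)"
proof -
  define \<rho> where "\<rho> = 1 / 2 powr (\<beta> * real n)"
  have \<rho>: "0 < \<rho>" "\<rho> \<le> 1" using \<beta> by (auto simp: \<rho>_def ge_one_powr_ge_zero)
  \<comment> \<open>One unit of slack for centres outside the window, as the radius is at most
    1.\<close>
  define J where "J = {- ((int N + 1) * 2 ^ n) .. (int N + 1) * 2 ^ n}"
  have cardJ: "real (card J) \<le> 2 * (real N + 2) * 2 ^ n"
  proof -
    have "int (card J) = 2 * (int N + 1) * 2 ^ n + 1" by (simp add: J_def algebra_simps)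
    then have "real (card J) = 2 * (real N + 1) * 2 ^ n + 1"
      by (metis (mono_tags, lifting) of_int_1 of_int_add of_int_mult of_int_numeral of_int_of_nat_eq of_int_power)
    moreover have "(1::real) \<le> 2 * 2 ^ n" using one_le_power[of "2::real" n] by linarith
    ultimately show ?thesis by (simp add: algebra_simps)
  qed
  have "U_set \<beta> n \<inter> {- real N..real N} \<subseteq> (\<Union>j\<in>J. Int_nj \<beta> n j)"
  proof
    fix x assume "x \<in> U_set \<beta> n \<inter> {- real N..real N}"
    then obtain j where j: "x \<in> Int_nj \<beta> n j" and x: "\<bar>x\<bar> \<le> real N" by (auto simp: U_set_def)
    have "\<bar>real_of_int j / 2 ^ n\<bar> \<le> real N + 1"
      using j x \<rho> unfolding Int_nj_def \<rho>_def[symmetric] by auto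
    then have "\<bar>real_of_int j\<bar> \<le> (real N + 1) * 2 ^ n" by (simp add: abs_divide divide_le_eq)
    then have "real_of_int \<bar>j\<bar> \<le> real_of_int ((int N + 1) * 2 ^ n)" by simp
    then have "\<bar>j\<bar> \<le> (int N + 1) * 2 ^ n" by (simp only: of_int_le_iff)
    then have "j \<in> J" by (auto simp: J_def)
    then show "x \<in> (\<Union>j\<in>J. Int_nj \<beta> n j)" using j by blast
  qed
  then have "emeasure lborel (U_set \<beta> n \<inter> {- real N..real N}) \<le> emeasure lborel (\<Union>j\<in>J. Int_nj \<beta> n j)"
    by (rule emeasure_mono) (auto simp: Int_nj_def J_def)
  also have "\<dots> \<le> (\<Sum>j\<in>J. emeasure lborel (Int_nj \<beta> n j))"
    by (rule emeasure_subadditive_finite) (auto simp: Int_nj_def J_def)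
  also have "\<dots> = (\<Sum>j\<in>J. ennreal (2 * \<rho>))"
    using \<rho> by (intro sum.cong refl) (auto simp: Int_nj_def \<rho>_def[symmetric])
  also have "\<dots> = ennreal (real (card J) * (2 * \<rho>))"
    using \<rho> by (simp add: ennreal_mult ennreal_of_nat_eq_real_of_nat)
  also have "\<dots> \<le> ennreal (2 * (real N + 2) * 2 ^ n * (2 * \<rho>))"
    using cardJ \<rho> by (intro ennreal_leI mult_right_mono) auto
  also have "2 * (real N + 2) * 2 ^ n * (2 * \<rho>) = 4 * (real N + 2) * (2 powr (1 - \<beta>)) ^ n"
  proof -
    have "2 ^ n * \<rho> = 2 powr (real n - \<beta> * real n)"
      by (simp add: \<rho>_def powr_diff powr_realpow)
    also have "\<dots> = (2 powr (1 - \<beta>)) ^ n"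
      by (simp add: powr_realpow[symmetric] powr_powr algebra_simps)
    finally have "2 ^ n * \<rho> = (2 powr (1 - \<beta>)) ^ n" .
    moreover have "2 * (real N + 2) * 2 ^ n * (2 * \<rho>) = 4 * (real N + 2) * (2 ^ n * \<rho>)" by simp
    ultimately show ?thesis by simp
  qed
  finally show ?thesis .
qed

text \<open>Borel-Cantelli in each bounded window: the measures there are summable, so almost every
  point lies in only finitely many \<open>U_set \<beta> n\<close> and avoids all of them from some
  level on.\<close>

lemma AE_K_set:
  assumes \<beta>: "\<beta> > 1"
  shows "AE x in lborel. \<exists>n\<ge>1. x \<in> K_set \<beta> n"
proof -
  define q where "q = 2 powr (1 - \<beta>)"
  have q: "0 < q" "q < 1" using \<beta> powr_less_mono[of "1 - \<beta>" 0 2] by (auto simp: q_def)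
  have "AE x in lborel. eventually (\<lambda>n. x \<in> space lborel - (U_set \<beta> n \<inter> {- real N..real N})) sequentially" for N :: nat
  proof (rule borel_cantelli_AE1)
    fix n
    have le: "emeasure lborel (U_set \<beta> n \<inter> {- real N..real N}) \<le> ennreal (4 * (real N + 2) * q ^ n)"
      using emeasure_U_set_le[of \<beta> n N] \<beta> by (simp add: q_def)
    also have "\<dots> < \<infinity>" by simp
    finally show "emeasure lborel (U_set \<beta> n \<inter> {- real N..real N}) < \<infinity>" .
  next
    show "summable (\<lambda>n. measure lborel (U_set \<beta> n \<inter> {- real N..real N}))"
    proof (rule summable_comparison_test')
      show "summable (\<lambda>n. 4 * (real N + 2) * q ^ n)" using q by (intro summable_mult summable_geometric) auto
      show "norm (measure lborel (U_set \<beta> n \<inter> {- real N..real N})) \<le> 4 * (real N + 2) * q ^ n" for n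
        using emeasure_U_set_le[of \<beta> n N] \<beta> q
        by (simp add: q_def[symmetric] measure_def enn2real_leI)
    qed
  qed (use open_U_set in auto)
  then have "AE x in lborel. \<forall>N::nat. eventually (\<lambda>n. x \<in> space lborel - (U_set \<beta> n \<inter> {- real N..real N})) sequentially"
    by (simp only: AE_all_countable) blast
  then show ?thesis
  proof eventually_elim
    case (elim x)
    obtain N :: nat where "\<bar>x\<bar> \<le> real N" using real_arch_simple by blast
    then have "eventually (\<lambda>n. x \<notin> U_set \<beta> n) sequentially"
      by (intro eventually_mono[OF spec[OF elim, of N]]) auto
    then obtain n where n: "\<And>i. i \<ge> n \<Longrightarrow> x \<notin> U_set \<beta> i" by (auto simp: eventually_sequentially)
    then have "x \<in> K_set \<beta> (max n 1)" by (auto simp: K_set_def U_hat_def)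
    then show ?case by (intro exI[of _ "max n 1"]) auto
  qed
qed

text \<open>An interval has positive measure, so by \<open>AE_K_set\<close> it meets some
  \<open>K_set\<close>; monotonicity in the level yields one level for finitely many intervals. This
  makes the gaps of \<open>K_set\<close> short inside a bounded window.\<close>

lemma K_set_meets_intervals:
  assumes \<beta>: "\<beta> > 1" and "finite I" "\<And>a b. (a, b) \<in> I \<Longrightarrow> a < b"
  shows "\<exists>n\<ge>1. \<forall>(a, b)\<in>I. \<exists>c\<in>K_set \<beta> n. a < c \<and> c < b"
  using assms(2,3)
proof (induction I)
  case (insert i I)
  obtain n where n: "n \<ge> 1" "\<forall>(a, b)\<in>I. \<exists>c\<in>K_set \<beta> n. a < c \<and> c < b"
    using insert.IH insert.prems by auto
  obtain a b where i: "i = (a, b)" by (cases i)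
  have ab: "a < b" using insert.prems[of a b] i by simp
  have "\<not> (AE x in lborel. x \<notin> {a<..<b})"
    using ab by (subst AE_iff_null_sets[symmetric]) (auto simp: null_sets_def)
  moreover have "AE x in lborel. x \<notin> {a<..<b}" if "\<nexists>m c. m \<ge> 1 \<and> c \<in> K_set \<beta> m \<and> a < c \<and> c < b"
    using AE_K_set[OF \<beta>] by eventually_elim (use that in auto)
  ultimately obtain m c where m: "m \<ge> 1" "c \<in> K_set \<beta> m" "a < c" "c < b" by blast
  have "K_set \<beta> n \<subseteq> K_set \<beta> (max n m)" "K_set \<beta> m \<subseteq> K_set \<beta> (max n m)"
    by (auto intro!: K_set_mono)
  then have "\<forall>(a, b)\<in>insert i I. \<exists>c\<in>K_set \<beta> (max n m). a < c \<and> c < b"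
    using n m i by fast
  then show ?case using n(1) by (intro exI[of _ "max n m"]) auto
qed auto

section \<open>Smoothing and oscillation\<close>

lemma hoelder_continuous_on:
  fixes f :: "real \<Rightarrow> real"
  assumes "0 < \<alpha>" and hoelder: "\<And>x y. \<bar>f x - f y\<bar> \<le> H * \<bar>x - y\<bar> powr \<alpha>"
  shows "continuous_on A f"
proof (rule continuous_at_imp_continuous_on, intro ballI)
  fix x
  have "((\<lambda>y. H * \<bar>y - x\<bar> powr \<alpha>) \<longlongrightarrow> H * \<bar>x - x\<bar> powr \<alpha>) (at x)"
    by (intro tendsto_intros) (use assms in auto)
  then have "((\<lambda>y. H * \<bar>y - x\<bar> powr \<alpha>) \<longlongrightarrow> 0) (at x)" by simp
  then have "((\<lambda>y. f y - f x) \<longlongrightarrow> 0) (at x)"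
    by (rule Lim_null_comparison[rotated]) (use hoelder in auto)
  then show "isCont f x" unfolding isCont_def by (simp add: LIM_zero_iff)
qed

locale hoelder_class =
  fixes \<alpha> \<beta> H :: real and \<Lambda> :: "nat \<Rightarrow> real"
  assumes \<alpha>: "0 < \<alpha>" "\<alpha> < 1" and \<beta>: "\<beta> > 1" and H: "H > 0"
    and \<Lambda>_ge: "\<And>n. n \<ge> 1 \<Longrightarrow> \<Lambda> n \<ge> 2 powr ((1 - \<alpha>) * \<beta> * real n)"
begin

abbreviation "X \<equiv> X_space \<alpha> \<beta> H \<Lambda>"

lemma \<Lambda>_pos: "n \<ge> 1 \<Longrightarrow> \<Lambda> n > 0"
  using \<Lambda>_ge[of n] powr_gt_zero[of 2 "(1 - \<alpha>) * \<beta> * real n"] by linarith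

text \<open>
  Only gaps inside a bounded window are interpolated, because the primitive of the change in
  the derivative has to stay uniformly small on the whole line. The ends of the window are taken
  in \<open>K_set \<beta> n\<close>, so that all gap ends obey the Lipschitz bounds.
\<close>

lemma piecewise_smoothing:
  assumes f: "f \<in> X" and R: "R > 0" and e: "e > 0"
  obtains f1 L where "f1 \<in> X" "C1b_dist f f1 \<le> e" "L > 0"
    "\<And>x y. x \<in> {-R..R} \<Longrightarrow> y \<in> {-R..R} \<Longrightarrow> \<bar>deriv f1 x - deriv f1 y\<bar> \<le> L * \<bar>x - y\<bar>"
proof -
  note fX = X_space_D[OF f]
  define \<phi> where "\<phi> = deriv f"
  \<comment> \<open>Gap ends will be within \<open>2 * \<delta>\<close> of the point, so
    \<open>\<eta>\<close> bounds the change of the derivative. The choice makes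
    \<open>\<eta> * (2 * R + 5)\<close>, which dominates the resulting change in
    \<open>C1b_dist\<close>, at most \<open>e\<close>.\<close>
  define \<delta> where "\<delta> = min 1 ((e / (H * (2 * R + 5))) powr (1 / \<alpha>) / 2)"
  define \<eta> where "\<eta> = H * (2 * \<delta>) powr \<alpha>"
  have \<delta>: "0 < \<delta>" "\<delta> \<le> 1" using e H R by (auto simp: \<delta>_def)
  have \<eta>: "0 \<le> \<eta>" "\<eta> * (2 * R + 5) \<le> e"
  proof -
    have "2 * \<delta> \<le> (e / (H * (2 * R + 5))) powr (1 / \<alpha>)" by (auto simp: \<delta>_def min_def)
    then have "(2 * \<delta>) powr \<alpha> \<le> ((e / (H * (2 * R + 5))) powr (1 / \<alpha>)) powr \<alpha>"
      using \<delta> \<alpha> by (intro powr_mono2) auto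
    also have "\<dots> = e / (H * (2 * R + 5))" using \<alpha> e H R by (simp add: powr_powr)
    finally have "(2 * \<delta>) powr \<alpha> * (H * (2 * R + 5)) \<le> e" using H R by (simp add: pos_le_divide_eq)
    then show "\<eta> * (2 * R + 5) \<le> e" by (simp add: \<eta>_def algebra_simps)
    show "0 \<le> \<eta>" using H by (simp add: \<eta>_def)
  qed
  define I where "I = {\<lfloor>- (R + 2) / \<delta>\<rfloor>..\<lceil>(R + 2) / \<delta>\<rceil>}"
  \<comment> \<open>The two end cells provide the ends of the window; the grid cells of width
    \<open>\<delta>\<close> put points of \<open>K_set\<close> close to each point on both
    sides.\<close>
  define cells where "cells = insert (- R - 1, - R) (insert (R, R + 1) ((\<lambda>i. (of_int i * \<delta>, (of_int i + 1) * \<delta>)) ` I))"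
  have "finite cells" by (auto simp: cells_def I_def)
  moreover have "a < b" if "(a, b) \<in> cells" for a b using that \<delta> by (auto simp: cells_def)
  ultimately obtain n where n: "n \<ge> 1" and meets: "\<And>a b. (a, b) \<in> cells \<Longrightarrow> \<exists>c\<in>K_set \<beta> n. a < c \<and> c < b"
    using K_set_meets_intervals[OF \<beta>, of cells] by blast
  obtain a where a: "a \<in> K_set \<beta> n" "- R - 1 < a" "a < - R" using meets[of "- R - 1" "- R"] by (auto simp: cells_def)
  obtain b where b: "b \<in> K_set \<beta> n" "R < b" "b < R + 1" using meets[of R "R + 1"] by (auto simp: cells_def)
  define C where "C = K_set \<beta> n \<union> {..a} \<union> {b..}"
  interpret C: two_sided_closed C
  proof
    show "closed C" unfolding C_def by (intro closed_Un closed_K_set) auto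
    show "\<exists>c\<in>C. c \<le> x" for x by (intro bexI[of _ "min a x"]) (auto simp: C_def)
    show "\<exists>c\<in>C. x \<le> c" for x by (intro bexI[of _ "max b x"]) (auto simp: C_def)
  qed
  have near: "x - 2 * \<delta> \<le> gap_lo C x" "gap_hi C x \<le> x + 2 * \<delta>" for x
  proof -
    have "\<exists>c\<in>C. x \<le> c \<and> c \<le> x + 2 * \<delta>" "\<exists>c\<in>C. x - 2 * \<delta> \<le> c \<and> c \<le> x"
    proof (atomize (full), cases "x \<le> a \<or> b \<le> x")
      case True
      then have "x \<in> C" by (auto simp: C_def)
      then show "(\<exists>c\<in>C. x \<le> c \<and> c \<le> x + 2 * \<delta>) \<and> (\<exists>c\<in>C. x - 2 * \<delta> \<le> c \<and> c \<le> x)"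
        using \<delta> by (intro conjI bexI[of _ x]) auto
    next
      case False
      then have x: "- R - 1 < x" "x < R + 1" using a b by auto
      \<comment> \<open>The cell used on the right starts at the first grid point not before
        \<open>x\<close>; the one used on the left, indexed by \<open>j\<close> below, ends at the
        last grid point not after \<open>x\<close>.\<close>
      define i where "i = \<lceil>x / \<delta>\<rceil>"
      have "- (R + 2) / \<delta> \<le> x / \<delta>" "x / \<delta> \<le> (R + 2) / \<delta>"
        using x \<delta> by (intro divide_right_mono; simp)+
      then have "i \<in> I" unfolding I_def i_def atLeastAtMost_iff
        by (intro conjI order_trans[OF floor_mono floor_le_ceiling] ceiling_mono)
      then obtain c where c: "c \<in> K_set \<beta> n" "of_int i * \<delta> < c" "c < (of_int i + 1) * \<delta>"
        using meets[of "of_int i * \<delta>" "(of_int i + 1) * \<delta>"] by (auto simp: cells_def)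
      have "x / \<delta> \<le> of_int i" "of_int i < x / \<delta> + 1" unfolding i_def by linarith+
      then have "x \<le> of_int i * \<delta>" "of_int i * \<delta> < x + \<delta>" using \<delta> by (simp_all add: field_simps)
      then have 1: "x \<le> c" "c \<le> x + 2 * \<delta>" using c by (auto simp: algebra_simps)
      define j where "j = \<lfloor>(x - \<delta>) / \<delta>\<rfloor>"
      have "- (R + 2) / \<delta> \<le> (x - \<delta>) / \<delta>" "(x - \<delta>) / \<delta> \<le> (R + 2) / \<delta>"
        using x \<delta> by (intro divide_right_mono; simp)+
      then have "j \<in> I" unfolding I_def j_def atLeastAtMost_iff
        by (intro conjI order_trans[OF floor_le_ceiling ceiling_mono] floor_mono)
      then obtain d where d: "d \<in> K_set \<beta> n" "of_int j * \<delta> < d" "d < (of_int j + 1) * \<delta>"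
        using meets[of "of_int j * \<delta>" "(of_int j + 1) * \<delta>"] by (auto simp: cells_def)
      have "of_int j \<le> (x - \<delta>) / \<delta>" "(x - \<delta>) / \<delta> < of_int j + 1" unfolding j_def by linarith+
      then have "of_int j * \<delta> \<le> x - \<delta>" "x - \<delta> < of_int j * \<delta> + \<delta>" using \<delta> by (simp_all add: field_simps)
      then have 2: "x - 2 * \<delta> \<le> d" "d \<le> x" using d by (auto simp: algebra_simps)
      show "(\<exists>c\<in>C. x \<le> c \<and> c \<le> x + 2 * \<delta>) \<and> (\<exists>c\<in>C. x - 2 * \<delta> \<le> c \<and> c \<le> x)"
        using 1 2 c d by (auto simp: C_def)
    qed
    then show "x - 2 * \<delta> \<le> gap_lo C x" "gap_hi C x \<le> x + 2 * \<delta>"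
      using C.le_gap_lo C.gap_hi_le by (meson order_trans)+
  qed
  define P where "P = gap_interp C \<phi>"
  have PC: "P x = \<phi> x" if "x \<in> C" for x using C.gap_interp_mem[OF that] by (simp add: P_def)
  have P\<phi>: "\<bar>P x - \<phi> x\<bar> \<le> \<eta>" for x
  proof -
    obtain t where t: "0 \<le> t" "t \<le> 1"
      "\<And>\<phi>. gap_interp C \<phi> x = (1 - t) * \<phi> (gap_lo C x) + t * \<phi> (gap_hi C x)"
      using C.gap_interp_convex[of x] by metis
    have close: "\<bar>\<phi> z - \<phi> x\<bar> \<le> \<eta>" if "\<bar>z - x\<bar> \<le> 2 * \<delta>" for z
    proof -
      have "\<bar>\<phi> z - \<phi> x\<bar> \<le> H * \<bar>z - x\<bar> powr \<alpha>" unfolding \<phi>_def by (rule fX)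
      also have "\<dots> \<le> \<eta>" unfolding \<eta>_def using that H \<alpha> by (intro mult_left_mono powr_mono2) auto
      finally show ?thesis .
    qed
    have "P x - \<phi> x = (1 - t) * (\<phi> (gap_lo C x) - \<phi> x) + t * (\<phi> (gap_hi C x) - \<phi> x)"
      unfolding P_def t(3) by (simp add: algebra_simps)
    then show ?thesis
      using close[of "gap_lo C x"] close[of "gap_hi C x"] near[of x] C.gap_lo(2)[of x] C.gap_hi(2)[of x] \<delta>
      by (simp add: abs_convex_combination_le[OF t(1,2)])
  qed
  have P0: "0 \<le> P x" for x
  proof -
    obtain t where t: "0 \<le> t" "t \<le> 1"
      "\<And>\<phi>. gap_interp C \<phi> x = (1 - t) * \<phi> (gap_lo C x) + t * \<phi> (gap_hi C x)"
      using C.gap_interp_convex[of x] by metis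
    show ?thesis unfolding P_def t(3) using t fX(2) by (simp add: \<phi>_def)
  qed
  have PH: "\<bar>P x - P y\<bar> \<le> H * \<bar>x - y\<bar> powr \<alpha>" for x y
    unfolding P_def
    by (rule C.gap_interp_modulus[OF concave_on_powr, of _ _ UNIV]) (use \<alpha> H fX(3) in \<open>auto simp: \<phi>_def\<close>)
  \<comment> \<open>For levels \<open>m \<ge> n\<close> the Lipschitz bound on
    \<open>K_set \<beta> m\<close> is transferred through the gap ends. For \<open>m < n\<close>
    nothing changes on \<open>K_set \<beta> m\<close>, since it lies in \<open>C\<close>.\<close>
  have gapK: "gap_lo C x \<in> K_set \<beta> m" "gap_hi C x \<in> K_set \<beta> m"
    if m: "n \<le> m" and x: "x \<in> K_set \<beta> m \<or> a \<le> x \<and> x \<le> b" for x m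
  proof -
    have sub: "K_set \<beta> n \<subseteq> K_set \<beta> m" by (rule K_set_mono[OF m])
    have inside: "z \<in> K_set \<beta> n" if "z \<in> C" "a \<le> z" "z \<le> b" for z
      using that a b by (cases "z = a"; cases "z = b") (auto simp: C_def)
    have "gap_lo C x \<in> K_set \<beta> m \<and> gap_hi C x \<in> K_set \<beta> m"
    proof (cases "x \<in> C")
      case True
      then have "x \<in> K_set \<beta> m" using x sub a b by (auto simp: C_def)
      then show ?thesis using True C.gap_mem[of x] by simp
    next
      case False
      then have "a \<le> x" "x \<le> b" by (auto simp: C_def)
      then have "a \<le> gap_lo C x" "gap_hi C x \<le> b"
        using C.le_gap_lo[of a x] C.gap_hi_le[of b x] by (auto simp: C_def)
      then have "gap_lo C x \<in> K_set \<beta> n" "gap_hi C x \<in> K_set \<beta> n"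
        using C.gap_lo[of x] C.gap_hi[of x] \<open>a \<le> x\<close> \<open>x \<le> b\<close> inside by auto
      then show ?thesis using sub by auto
    qed
    then show "gap_lo C x \<in> K_set \<beta> m" "gap_hi C x \<in> K_set \<beta> m" by auto
  qed
  have Plip: "\<bar>P x - P y\<bar> \<le> \<Lambda> m * \<bar>x - y\<bar>"
    if m: "n \<le> m" and x: "x \<in> K_set \<beta> m \<or> a \<le> x \<and> x \<le> b" and y: "y \<in> K_set \<beta> m \<or> a \<le> y \<and> y \<le> b" for x y m
    unfolding P_def
    by (rule C.gap_interp_modulus[OF concave_on_linear _ _ gapK[OF m x] gapK[OF m y]])
       (use fX(4)[of m] n m in \<open>auto simp: \<phi>_def\<close>)
  have PK: "\<bar>P x - P y\<bar> \<le> \<Lambda> m * \<bar>x - y\<bar>" if m: "1 \<le> m" and xy: "x \<in> K_set \<beta> m" "y \<in> K_set \<beta> m" for x y m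
  proof (cases "n \<le> m")
    case True
    then show ?thesis using Plip xy by blast
  next
    case False
    then have "K_set \<beta> m \<subseteq> C" using K_set_mono[of m n \<beta>] by (auto simp: C_def)
    then have "P x = \<phi> x" "P y = \<phi> y" using PC xy by auto
    then show ?thesis using fX(4)[OF m xy] by (simp add: \<phi>_def)
  qed
  have contP: "continuous_on UNIV P" by (rule hoelder_continuous_on[OF \<alpha>(1) PH])
  have cont\<phi>: "continuous_on UNIV \<phi>" unfolding \<phi>_def by (rule C1b_continuous[OF fX(1)])
  have "\<exists>D. (\<forall>x. (D has_real_derivative P x - \<phi> x) (at x)) \<and> (\<forall>x. \<bar>D x\<bar> \<le> \<eta> * (b - a))"
  proof (rule antiderivative_bounded_support[of "\<lambda>x. P x - \<phi> x" a b \<eta>])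
    show "continuous_on UNIV (\<lambda>x. P x - \<phi> x)" by (intro continuous_intros contP cont\<phi>)
    show "P x - \<phi> x = 0" if "x \<notin> {a..b}" for x using PC[of x] that by (auto simp: C_def)
  qed (use a b R P\<phi> in auto)
  then obtain D where D: "\<And>x. (D has_real_derivative P x - \<phi> x) (at x)" "\<And>x. \<bar>D x\<bar> \<le> \<eta> * (b - a)"
    by blast
  have D': "\<bar>D x\<bar> \<le> \<eta> * (2 * R + 2)" for x
    using D(2)[of x] mult_left_mono[of "b - a" "2 * R + 2" \<eta>] a b \<eta> by auto
  define f1 where "f1 x = f x + D x" for x
  obtain B B' where B: "\<And>x. \<bar>f x\<bar> \<le> B" "\<And>x. \<bar>deriv f x\<bar> \<le> B'" using C1b_bdd[OF fX(1)] by blast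
  have der: "(f1 has_real_derivative P x) (at x)" for x
    unfolding f1_def using DERIV_add[OF C1b_DERIV[OF fX(1)] D(1), of x] by (simp add: \<phi>_def)
  have bd: "\<bar>f1 x\<bar> \<le> B + \<eta> * (2 * R + 2)" "\<bar>P x\<bar> \<le> B' + \<eta>" for x
    using B[of x] D'[of x] P\<phi>[of x] unfolding f1_def \<phi>_def by linarith+
  have f1: "f1 \<in> X" "deriv f1 = P"
    by (rule X_space_I[OF der contP bd P0 PH PK]; assumption)+
  have "C1b_dist f f1 \<le> \<eta> * (2 * R + 2) + \<eta>"
    by (rule C1b_dist_le)
       (use fX(1) X_space_D(1)[OF f1(1)] D' P\<phi> in \<open>auto simp: f1(2) f1_def \<phi>_def abs_minus_commute\<close>)
  also have "\<dots> \<le> \<eta> * (2 * R + 5)" using \<eta> by (simp add: algebra_simps)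
  also have "\<dots> \<le> e" by (rule \<eta>)
  finally have "C1b_dist f f1 \<le> e" .
  moreover have "\<bar>deriv f1 x - deriv f1 y\<bar> \<le> \<Lambda> n * \<bar>x - y\<bar>" if "x \<in> {-R..R}" "y \<in> {-R..R}" for x y
    unfolding f1 by (rule Plip) (use that a b in auto)
  ultimately show ?thesis using that f1(1) \<Lambda>_pos[OF n] by blast
qed

text \<open>
  The constants are tuned so that a tent of slope \<open>\<rho> powr (\<alpha> - 1)\<close> and width \<open>\<rho>\<close> just satisfies
  the Hoelder bound, while its slope is admissible for every \<open>K_set \<beta> m\<close> that meets its support.
\<close>

lemma bumps:
  fixes R :: real and k :: nat
  assumes k: "k \<ge> 1" and R: "R > 0"
  defines "\<rho> \<equiv> 1 / 2 powr (\<beta> * real k)"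
  obtains w where "w \<in> X" "\<And>x. \<bar>w x\<bar> \<le> 2 * R + 2" "\<And>x. \<bar>deriv w x\<bar> \<le> 1"
    "\<And>x. x \<notin> U_set \<beta> k \<Longrightarrow> deriv w x = 0"
    "\<And>x y. x \<le> y \<Longrightarrow> w x \<le> w y"
    "\<And>j. \<bar>of_int j / 2 ^ k\<bar> \<le> R \<Longrightarrow>
      w (of_int j / 2 ^ k + \<rho>) - w (of_int j / 2 ^ k - \<rho>) \<ge> min 1 H * \<rho> powr (1 + \<alpha>) / 2"
proof -
  define c where "c = min 1 H"
  \<comment> \<open>The peak \<open>s * \<rho>\<close> is c \<rho>^\<alpha>: in the Hoelder
    estimate, distances up to \<open>\<rho>\<close> are handled by the slope and larger ones by the
    height. \<open>c \<le> H\<close> serves that estimate, \<open>c \<le> 1\<close> the bound on the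
    derivative and the comparison of \<open>s\<close> with \<open>\<Lambda>\<close>.\<close>
  define s where "s = c * \<rho> powr (\<alpha> - 1)"
  define D where "D = {p \<in> {-R..R}. \<exists>j::int. p = of_int j / 2 ^ k}"
  \<comment> \<open>Using the distance to the set of centres makes \<open>u\<close> Lipschitz with
    constant \<open>s\<close> without treating tents separately, even where they might
    overlap.\<close>
  define u where "u x = s * max 0 (\<rho> - infdist x D)" for x
  have c: "0 < c" "c \<le> 1" "c \<le> H" using H by (auto simp: c_def)
  have \<rho>: "0 < \<rho>" "\<rho> \<le> 1" using \<beta> by (auto simp: \<rho>_def ge_one_powr_ge_zero)
  have s: "0 < s" using c \<rho> by (auto simp: s_def)
  have s\<rho>: "s * \<rho> = c * \<rho> powr \<alpha>" using \<rho> by (simp add: s_def powr_diff)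
  have s\<rho>1: "s * \<rho> \<le> 1" unfolding s\<rho> using c \<rho> \<alpha> by (intro mult_le_one powr_le1) auto
  have "0 \<in> D" using R by (auto simp: D_def intro!: exI[of _ 0])
  then have D0: "D \<noteq> {}" by auto
  have u: "0 \<le> u x" "u x \<le> s * \<rho>" for x
    using s \<rho> infdist_nonneg[of x D] by (auto simp: u_def)
  have ulip: "\<bar>u x - u y\<bar> \<le> s * \<bar>x - y\<bar>" for x y
  proof -
    have "\<bar>infdist x D - infdist y D\<bar> \<le> \<bar>x - y\<bar>"
      using infdist_triangle_abs[of x D y] by (simp add: dist_real_def)
    then have "\<bar>max 0 (\<rho> - infdist x D) - max 0 (\<rho> - infdist y D)\<bar> \<le> \<bar>x - y\<bar>" by linarith
    then have "s * \<bar>max 0 (\<rho> - infdist x D) - max 0 (\<rho> - infdist y D)\<bar> \<le> s * \<bar>x - y\<bar>"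
      using s by (intro mult_left_mono) auto
    then show ?thesis unfolding u_def using s by (simp add: right_diff_distrib[symmetric] abs_mult)
  qed
  have uhoelder: "\<bar>u x - u y\<bar> \<le> H * \<bar>x - y\<bar> powr \<alpha>" for x y
  proof -
    have "\<bar>u x - u y\<bar> \<le> c * \<bar>x - y\<bar> powr \<alpha>"
    proof (cases "x = y")
      case False
      define t where "t = \<bar>x - y\<bar>"
      have t: "t > 0" using False by (simp add: t_def)
      have "\<bar>u x - u y\<bar> \<le> c * t powr \<alpha>"
      proof (cases "t \<le> \<rho>")
        case True
        have "\<rho> powr (\<alpha> - 1) \<le> t powr (\<alpha> - 1)" using True t \<alpha> by (intro powr_mono2') auto
        then have "s * t \<le> c * t powr (\<alpha> - 1) * t" using c t unfolding s_def by (intro mult_right_mono mult_left_mono) auto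
        also have "\<dots> = c * t powr \<alpha>" using t by (simp add: powr_diff)
        finally show ?thesis using ulip[of x y] by (simp add: t_def)
      next
        case False
        have "\<bar>u x - u y\<bar> \<le> s * \<rho>" using u[of x] u[of y] by linarith
        also have "\<dots> \<le> c * t powr \<alpha>" unfolding s\<rho> using False c \<rho> \<alpha> by (intro mult_left_mono powr_mono2) auto
        finally show ?thesis .
      qed
      then show ?thesis by (simp add: t_def)
    qed (use c in auto)
    also have "\<dots> \<le> H * \<bar>x - y\<bar> powr \<alpha>" using c by (intro mult_right_mono) auto
    finally show ?thesis .
  qed
  have contu: "continuous_on UNIV u" by (rule hoelder_continuous_on[OF \<alpha>(1) uhoelder])
  have nearD: "\<exists>p\<in>D. \<bar>x - p\<bar> < \<rho>" if "u x \<noteq> 0" for x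
  proof -
    have "infdist x D < \<rho>" using that by (auto simp: u_def max_def split: if_splits)
    then have "\<exists>p\<in>D. dist x p < \<rho>" using D0 by (subst (asm) infdist_notempty) (auto simp: cINF_less_iff)
    then show ?thesis by (simp add: dist_real_def)
  qed
  have uU: "u x = 0" if "x \<notin> U_set \<beta> k" for x
  proof (rule ccontr)
    assume "u x \<noteq> 0"
    then obtain p where "p \<in> D" "\<bar>x - p\<bar> < \<rho>" using nearD by blast
    then obtain j :: int where "\<bar>x - of_int j / 2 ^ k\<bar> < \<rho>" by (auto simp: D_def)
    then have "x \<in> Int_nj \<beta> k j" unfolding Int_nj_def \<rho>_def by auto
    then show False using that by (auto simp: U_set_def)
  qed
  have uK: "\<bar>u x - u y\<bar> \<le> \<Lambda> m * \<bar>x - y\<bar>" if m: "1 \<le> m" and xy: "x \<in> K_set \<beta> m" "y \<in> K_set \<beta> m" for x y m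
  \<comment> \<open>Levels up to \<open>k\<close> see no bump, since \<open>K_set \<beta> m\<close>
    then avoids \<open>U_set \<beta> k\<close>. At higher levels the assumed lower bound on
    \<open>\<Lambda> m\<close> dominates the slope \<open>s\<close>, which is at most
    2^((1-\<alpha>) \<beta> k).\<close>
  proof (cases "m \<le> k")
    case True
    then have "x \<notin> U_set \<beta> k" "y \<notin> U_set \<beta> k" using xy by (auto simp: K_set_def U_hat_def)
    then show ?thesis using uU \<Lambda>_pos[OF m] by simp
  next
    case False
    have "s \<le> \<rho> powr (\<alpha> - 1)" using c unfolding s_def by (simp add: mult_left_le_one_le)
    also have "\<dots> = 2 powr ((1 - \<alpha>) * \<beta> * real k)"
      by (simp add: \<rho>_def powr_divide powr_powr powr_minus_divide[symmetric] algebra_simps)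
    also have "\<dots> \<le> 2 powr ((1 - \<alpha>) * \<beta> * real m)" using False \<alpha> \<beta> by (intro powr_mono mult_left_mono) auto
    also have "\<dots> \<le> \<Lambda> m" by (rule \<Lambda>_ge[OF m])
    finally have "s * \<bar>x - y\<bar> \<le> \<Lambda> m * \<bar>x - y\<bar>" by (intro mult_right_mono) auto
    then show ?thesis using ulip[of x y] by linarith
  qed
  have usupp: "u x = 0" if "x \<notin> {-(R + 1)..R + 1}" for x
    using nearD[of x] that \<rho> by (force simp: D_def)
  have u1: "\<bar>u x\<bar> \<le> 1" for x using u[of x] s\<rho>1 by auto
  have ab: "- (R + 1) \<le> R + 1" using R by simp
  obtain w where w: "\<And>x. (w has_real_derivative u x) (at x)" "\<And>x. \<bar>w x\<bar> \<le> 1 * ((R + 1) - (- (R + 1)))"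
    using antiderivative_bounded_support[OF contu ab usupp u1] by metis
  have wX: "w \<in> X" "deriv w = u"
    by (rule X_space_I[OF w(1) contu w(2) u1 u(1) uhoelder uK]; assumption)+
  have wmono: "w x \<le> w y" if "x \<le> y" for x y
    using DERIV_nonneg_imp_nondecreasing[OF that, of w] w(1) u(1) by blast
  have osc: "w (p + \<rho>) - w (p - \<rho>) \<ge> c * \<rho> powr (1 + \<alpha>) / 2" if p: "p \<in> D" for p
  proof -
    \<comment> \<open>On the middle half of the tent \<open>u\<close> is at least half of its peak;
      monotonicity of \<open>w\<close> extends the increment to the full tent.\<close>
    have "\<exists>z>p - \<rho>/2. z < p + \<rho>/2 \<and> w (p + \<rho>/2) - w (p - \<rho>/2) = (p + \<rho>/2 - (p - \<rho>/2)) * u z"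
      by (rule MVT2) (use \<rho> w(1) in auto)
    then obtain z where "p - \<rho>/2 < z" "z < p + \<rho>/2" "w (p + \<rho>/2) - w (p - \<rho>/2) = (p + \<rho>/2 - (p - \<rho>/2)) * u z"
      by blast
    then have z: "\<bar>z - p\<bar> < \<rho> / 2" "w (p + \<rho>/2) - w (p - \<rho>/2) = \<rho> * u z"
      by (linarith, simp)
    have "infdist z D \<le> \<bar>z - p\<bar>" using infdist_le[OF p, of z] by (simp add: dist_real_def)
    then have "\<rho> / 2 \<le> max 0 (\<rho> - infdist z D)" using z(1) by linarith
    then have "s * (\<rho> / 2) \<le> u z" unfolding u_def using s by (intro mult_left_mono) auto
    then have "\<rho> * (s * (\<rho> / 2)) \<le> w (p + \<rho>/2) - w (p - \<rho>/2)" unfolding z(2) using \<rho> by (intro mult_left_mono) auto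
    also have "\<dots> \<le> w (p + \<rho>) - w (p - \<rho>)"
      using wmono[of "p + \<rho>/2" "p + \<rho>"] wmono[of "p - \<rho>" "p - \<rho>/2"] \<rho> by simp
    also have "\<rho> * (s * (\<rho> / 2)) = c * \<rho> powr (1 + \<alpha>) / 2"
      using s\<rho> \<rho> by (simp add: powr_add)
    finally show ?thesis .
  qed
  have "w (of_int j / 2 ^ k + \<rho>) - w (of_int j / 2 ^ k - \<rho>) \<ge> min 1 H * \<rho> powr (1 + \<alpha>) / 2"
    if "\<bar>of_int j / 2 ^ k\<bar> \<le> R" for j :: int
  proof -
    have "of_int j / 2 ^ k \<in> {-R..R}" unfolding atLeastAtMost_iff using that by linarith
    then show ?thesis unfolding c_def[symmetric] by (intro osc) (auto simp: D_def)
  qed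
  then show ?thesis using that[of w] wX w(2) u1 uU wmono by auto
qed

end

section \<open>Contact with functions of class C11\<close>

lemma fmeasurable_subset_Icc:
  fixes a b :: real
  assumes "S \<in> sets borel" "S \<subseteq> {a..b}"
  shows "S \<in> fmeasurable lborel"
proof (rule fmeasurableI)
  have "emeasure lborel S \<le> emeasure lborel {a..b}" using assms by (intro emeasure_mono) auto
  also have "\<dots> < \<infinity>" by (auto simp: emeasure_lborel_Icc_eq)
  finally show "emeasure lborel S < \<infinity>" .
qed (use assms in auto)

text \<open>On \<open>K\<close> near \<open>x\<close> the first-order error of \<open>\<phi>\<close>
  equals that of \<open>\<psi>\<close>, so the bad set is disjoint from \<open>K\<close> in small
  balls, and \<open>K\<close> has density 1 at \<open>x\<close>. Continuity of \<open>\<phi>\<close>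
  makes the bad set open, hence measurable.\<close>

lemma approx_differentiable_at_lipschitz_extension:
  assumes cont: "continuous_on UNIV \<phi>" and K: "closed K" and \<psi>: "(\<psi> has_real_derivative D) (at x)"
    and eq: "\<And>y. y \<in> K \<Longrightarrow> \<psi> y = \<phi> y" and x: "x \<in> K"
    and dens: "\<forall>e>0. \<exists>d>0. \<forall>a b. a < x \<and> x < b \<and> b - a < d \<longrightarrow> measure lborel (K \<inter> {a<..<b}) \<ge> (1 - e) * (b - a)"
  shows "approx_differentiable_at \<phi> x"
  unfolding approx_differentiable_at_def
proof (intro conjI exI[of _ D] allI impI)
  show "\<phi> \<in> borel_measurable lebesgue"
    using cont by (intro measurable_completion) (auto intro: borel_measurable_continuous_onI)
  fix \<epsilon> :: real assume \<epsilon>: "\<epsilon> > 0"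
  define B where "B = {y. \<bar>\<phi> y - \<phi> x - D * (y - x)\<bar> > \<epsilon> * \<bar>y - x\<bar>}"
  have "open B" unfolding B_def
    by (intro open_Collect_less continuous_intros cont continuous_on_subset[OF cont]) auto
  then have B: "B \<in> sets borel" by auto
  have Kb: "K \<in> sets borel" using K by auto
  have "((\<lambda>r. measure lebesgue (B \<inter> ball x r) / measure lebesgue (ball x r)) \<longlongrightarrow> 0) (at_right 0)"
  proof (rule tendstoI)
    fix e :: real assume e: "e > 0"
    obtain d where d: "d > 0" "\<And>a b. a < x \<Longrightarrow> x < b \<Longrightarrow> b - a < d \<Longrightarrow> measure lborel (K \<inter> {a<..<b}) \<ge> (1 - e/2) * (b - a)"
      using dens[rule_format, of "e/2"] e by auto
    have "(\<psi> has_derivative (\<lambda>h. D * h)) (at x)" using \<psi> by (simp add: has_field_derivative_def)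
    then obtain d1 where d1: "d1 > 0" "\<And>y. \<bar>y - x\<bar> < d1 \<Longrightarrow> \<bar>\<psi> y - \<psi> x - D * (y - x)\<bar> \<le> \<epsilon> * \<bar>y - x\<bar>"
      using \<epsilon> unfolding has_derivative_at_alt by auto
    have "eventually (\<lambda>r. r \<in> {0<..<min (d / 2) d1}) (at_right (0::real))"
      by (rule eventually_at_right_real) (use d d1 in auto)
    then show "eventually (\<lambda>r. dist (measure lebesgue (B \<inter> ball x r) / measure lebesgue (ball x r)) 0 < e) (at_right 0)"
    proof eventually_elim
      case (elim r)
      have r: "0 < r" "2 * r < d" "r < d1" using elim by auto
      have ball: "ball x r = {x - r<..<x + r}" by (auto simp: dist_real_def)
      have disj: "B \<inter> K \<inter> ball x r = {}"
      proof -
        have "y \<notin> B" if "y \<in> K" "y \<in> ball x r" for y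
          using d1(2)[of y] r that eq[of y] eq[OF x] by (simp add: B_def dist_real_def abs_minus_commute)
        then show ?thesis by blast
      qed
      have "measure lborel (B \<inter> ball x r) \<le> measure lborel (ball x r - (K \<inter> ball x r))"
      proof (rule measure_mono_fmeasurable)
        show "B \<inter> ball x r \<subseteq> ball x r - (K \<inter> ball x r)" using disj by blast
        show "ball x r - (K \<inter> ball x r) \<in> fmeasurable lborel"
          by (rule fmeasurable_subset_Icc[of _ "x - r" "x + r"]) (use Kb in \<open>auto simp: ball\<close>)
      qed (use B in auto)
      also have "\<dots> = measure lborel (ball x r) - measure lborel (K \<inter> ball x r)"
        by (rule measure_Diff) (use Kb r in \<open>auto simp: ball\<close>)
      also have "\<dots> \<le> 2 * r - (1 - e/2) * (2 * r)"
        using d(2)[of "x - r" "x + r"] r by (simp add: ball)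
      also have "\<dots> = e / 2 * (2 * r)" by (simp add: algebra_simps)
      finally have "measure lborel (B \<inter> ball x r) / (2 * r) \<le> e / 2" using r by (simp add: pos_divide_le_eq)
      moreover have "measure lebesgue (B \<inter> ball x r) = measure lborel (B \<inter> ball x r)" "measure lebesgue (ball x r) = 2 * r"
        using B r by (auto simp: ball)
      ultimately show ?case using e r by (simp add: abs_of_nonneg)
    qed
  qed
  then show "has_lebesgue_density B x 0" unfolding has_lebesgue_density_def using B by simp
qed

text \<open>The Lipschitz bound is asked only between \<open>x\<close> and \<open>x + t\<close>,
  because it will be available for the smoothed function just inside a window.\<close>

lemma taylor_remainder_le:
  fixes g :: "real \<Rightarrow> real"
  assumes g: "\<And>z. (g has_real_derivative g' z) (at z)" and t: "0 < t"
    and lip: "\<And>z. x \<le> z \<Longrightarrow> z \<le> x + t \<Longrightarrow> \<bar>g' z - g' x\<bar> \<le> L * \<bar>z - x\<bar>" and L: "0 \<le> L"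
  shows "\<bar>g (x + t) - g x - g' x * t\<bar> \<le> L * t\<^sup>2"
proof -
  obtain z where z: "x < z" "z < x + t" "g (x + t) - g x = (x + t - x) * g' z"
    using MVT2[of x "x + t" g g'] g t by auto
  have "\<bar>g (x + t) - g x - g' x * t\<bar> = t * \<bar>g' z - g' x\<bar>"
    using z t by (simp add: abs_mult[symmetric, of t, simplified abs_of_pos[OF t]] abs_mult algebra_simps)
  also have "\<dots> \<le> t * (L * t)"
  proof (intro mult_left_mono)
    have "\<bar>g' z - g' x\<bar> \<le> L * \<bar>z - x\<bar>" using lip z by simp
    also have "\<dots> \<le> L * t" using z L by (intro mult_left_mono) auto
    finally show "\<bar>g' z - g' x\<bar> \<le> L * t" .
  qed (use t in simp)
  finally show ?thesis by (simp add: power2_eq_square algebra_simps)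
qed

lemma half_power: "c / 2 ^ n = c * (1/2::real) ^ n"
  by (simp add: power_one_over)

lemma quarter_power: "c / 4 ^ n = c * ((1/2::real) ^ n)\<^sup>2"
  by (simp add: power_one_over power2_eq_square power_mult_distrib[symmetric])

text \<open>
  Asking for a single good \<open>t\<close> in a compact range, instead of a proportion of them, makes the
  condition stable under limits in \<open>f\<close> and \<open>x\<close>.
\<close>

definition contact_set :: "nat \<Rightarrow> (real \<Rightarrow> real) \<Rightarrow> real set" where
  "contact_set N f = {x \<in> {- real N..real N}. \<forall>n\<ge>N. \<exists>t\<in>{2 / 2 ^ n..4 / 2 ^ n}.
     \<bar>f (x + t) - f x - deriv f x * t\<bar> \<le> real N / 4 ^ n}"

text \<open>The limit is taken jointly in the function and in the point, with the steps
  \<open>t\<close> converging along a subsequence by compactness. A constant sequence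
  \<open>\<sigma>\<close> gives closedness of the contact set; a constant sequence \<open>Y\<close>
  gives semicontinuity of its measure.\<close>

lemma contact_set_limit:
  assumes f: "f \<in> C1b" and \<sigma>: "\<And>i. \<sigma> i \<in> C1b" and lim: "(\<lambda>i. C1b_dist (\<sigma> i) f) \<longlonglongrightarrow> 0"
    and X: "Y \<longlonglongrightarrow> x" and mem: "\<And>i. Y i \<in> contact_set N (\<sigma> i)"
  shows "x \<in> contact_set N f"
  unfolding contact_set_def mem_Collect_eq
proof (intro conjI allI impI)
  have "\<forall>i. Y i \<in> {- real N..real N}" using mem by (auto simp: contact_set_def)
  then show "x \<in> {- real N..real N}"
    using closed_sequentially[OF closed_atLeastAtMost, of Y _ _ x] X by auto
  fix n assume n: "N \<le> n"
  have "\<exists>t. t \<in> {2 / 2 ^ n..4 / 2 ^ n} \<and> \<bar>\<sigma> i (Y i + t) - \<sigma> i (Y i) - deriv (\<sigma> i) (Y i) * t\<bar> \<le> real N / 4 ^ n" for i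
    using mem[of i] n unfolding contact_set_def by blast
  then obtain t where t: "\<And>i. t i \<in> {2 / 2 ^ n..4 / 2 ^ n}"
    "\<And>i. \<bar>\<sigma> i (Y i + t i) - \<sigma> i (Y i) - deriv (\<sigma> i) (Y i) * t i\<bar> \<le> real N / 4 ^ n" by metis
  have "seq_compact {2 / 2 ^ n..4 / 2 ^ n :: real}" by (intro compact_imp_seq_compact compact_Icc)
  then obtain l r where l: "l \<in> {2 / 2 ^ n..4 / 2 ^ n}" "strict_mono r" "(t \<circ> r) \<longlonglongrightarrow> l"
    using t(1) by (blast elim: seq_compactE)
  have lim': "(\<lambda>i. C1b_dist (\<sigma> (r i)) f) \<longlonglongrightarrow> 0" and Yr: "(\<lambda>i. Y (r i)) \<longlonglongrightarrow> x" and tr: "(\<lambda>i. t (r i)) \<longlonglongrightarrow> l"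
    using LIMSEQ_subseq_LIMSEQ[OF lim l(2)] LIMSEQ_subseq_LIMSEQ[OF X l(2)] l(3) by (auto simp: o_def)
  have conv: "(\<lambda>i. \<sigma> (r i) (y i)) \<longlonglongrightarrow> f z" "(\<lambda>i. deriv (\<sigma> (r i)) (y i)) \<longlonglongrightarrow> deriv f z" if y: "y \<longlonglongrightarrow> z" for y z
  proof -
    have "(\<lambda>i. \<sigma> (r i) (y i) - f (y i)) \<longlonglongrightarrow> 0" "(\<lambda>i. deriv (\<sigma> (r i)) (y i) - deriv f (y i)) \<longlonglongrightarrow> 0"
      by (rule Lim_null_comparison[OF _ lim'], use le_C1b_dist[OF \<sigma> f] in simp)+
    moreover have "(\<lambda>i. f (y i)) \<longlonglongrightarrow> f z" "(\<lambda>i. deriv f (y i)) \<longlonglongrightarrow> deriv f z"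
      using C1b_continuous[OF f, of UNIV] y
      by (auto simp: continuous_on_eq_continuous_at intro: isCont_tendsto_compose)
    ultimately show "(\<lambda>i. \<sigma> (r i) (y i)) \<longlonglongrightarrow> f z" "(\<lambda>i. deriv (\<sigma> (r i)) (y i)) \<longlonglongrightarrow> deriv f z"
      using tendsto_add by fastforce+
  qed
  have "(\<lambda>i. \<bar>\<sigma> (r i) (Y (r i) + t (r i)) - \<sigma> (r i) (Y (r i)) - deriv (\<sigma> (r i)) (Y (r i)) * t (r i)\<bar>)
      \<longlonglongrightarrow> \<bar>f (x + l) - f x - deriv f x * l\<bar>"
    by (intro tendsto_intros conv Yr tr)
  then have "\<bar>f (x + l) - f x - deriv f x * l\<bar> \<le> real N / 4 ^ n"
    by (rule LIMSEQ_le_const2) (use t(2) in auto)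
  then show "\<exists>t\<in>{2 / 2 ^ n..4 / 2 ^ n}. \<bar>f (x + t) - f x - deriv f x * t\<bar> \<le> real N / 4 ^ n"
    using l(1) by blast
qed

lemma closed_contact_set:
  assumes "f \<in> C1b"
  shows "closed (contact_set N f)"
  unfolding closed_sequential_limits
proof (intro allI impI)
  fix Y x assume Y: "(\<forall>n. Y n \<in> contact_set N f) \<and> Y \<longlonglongrightarrow> x"
  have "C1b_dist f f = 0" using assms by (simp add: C1b_dist_eq)
  show "x \<in> contact_set N f" by (rule contact_set_limit[of f "\<lambda>_. f" Y]) (use assms Y \<open>C1b_dist f f = 0\<close> in auto)
qed

lemma contact_set_mono:
  assumes "N \<le> M"
  shows "contact_set N f \<subseteq> contact_set M f"
proof
  fix x assume x: "x \<in> contact_set N f"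
  have "real N / 4 ^ n \<le> real M / 4 ^ n" for n using assms by (intro divide_right_mono) auto
  then show "x \<in> contact_set M f" using x assms unfolding contact_set_def
    by (auto intro: order_trans) (meson order_trans)
qed

lemma contact_set_fmeasurable: "f \<in> C1b \<Longrightarrow> contact_set N f \<in> fmeasurable lborel"
  by (rule fmeasurable_subset_Icc[of _ "- real N" "real N"])
     (auto simp: borel_closed closed_contact_set, auto simp: contact_set_def)

text \<open>The limit superior of the contact sets of \<open>\<sigma> i\<close> is contained in that
  of \<open>f\<close>; continuity from above, available because all of them lie in one bounded
  window, carries the lower bound over.\<close>

lemma measure_contact_set_limit:
  assumes f: "f \<in> C1b" and \<sigma>: "\<And>i. \<sigma> i \<in> C1b" and lim: "(\<lambda>i. C1b_dist (\<sigma> i) f) \<longlonglongrightarrow> 0"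
    and ge: "\<And>i. c \<le> measure lborel (contact_set N (\<sigma> i))"
  shows "c \<le> measure lborel (contact_set N f)"
proof -
  define A where "A n = (\<Union>i\<in>{n..}. contact_set N (\<sigma> i))" for n
  have sub: "contact_set N g \<subseteq> {- real N..real N}" for g by (auto simp: contact_set_def)
  have cl: "contact_set N (\<sigma> i) \<in> sets borel" "contact_set N f \<in> sets borel" for i
    using closed_contact_set f \<sigma> by auto
  have A: "A n \<in> fmeasurable lborel" for n
    unfolding A_def by (rule fmeasurable_subset_Icc[of _ "- real N" "real N"]) (use cl sub in auto)
  have "decseq A" unfolding A_def decseq_def by force
  then have "(\<lambda>n. measure lborel (A n)) \<longlonglongrightarrow> measure lborel (\<Inter>n. A n)"
    by (intro Lim_measure_decseq) (use A in \<open>auto simp: fmeasurable_def less_top[symmetric]\<close>)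
  moreover have "c \<le> measure lborel (A n)" for n
    by (rule order_trans[OF ge[of n] measure_mono_fmeasurable]) (use A cl in \<open>auto simp: A_def\<close>)
  ultimately have "c \<le> measure lborel (\<Inter>n. A n)" by (intro LIMSEQ_le_const) auto
  also have "\<dots> \<le> measure lborel (contact_set N f)"
  proof (rule measure_mono_fmeasurable)
    show "(\<Inter>n. A n) \<subseteq> contact_set N f"
    proof
      fix x assume "x \<in> (\<Inter>n. A n)"
      then have "\<forall>n. \<exists>i\<ge>n. i \<in> {i. x \<in> contact_set N (\<sigma> i)}" by (auto simp: A_def)
      then obtain r :: "nat \<Rightarrow> nat" where r: "strict_mono r" "\<And>n. x \<in> contact_set N (\<sigma> (r n))"
        using infinite_enumerate[of "{i. x \<in> contact_set N (\<sigma> i)}"] by (auto simp: infinite_nat_iff_unbounded_le)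
      show "x \<in> contact_set N f"
        by (rule contact_set_limit[of f "\<lambda>i. \<sigma> (r i)" "\<lambda>_. x"])
           (use f \<sigma> r LIMSEQ_subseq_LIMSEQ[OF lim r(1)] in \<open>auto simp: o_def\<close>)
    qed
    show "(\<Inter>n. A n) \<in> sets lborel" using A by (auto simp: fmeasurable_def)
    show "contact_set N f \<in> fmeasurable lborel" by (rule contact_set_fmeasurable[OF f])
  qed
  finally show ?thesis .
qed

lemma C11_DERIV:
  assumes "g \<in> C11"
  shows "(g has_real_derivative deriv g x) (at x)"
proof -
  obtain D where "(g has_real_derivative D x) (at x)"
    using assms by (auto simp: C11_def C1_differentiable_on_def has_real_derivative_iff_has_vector_derivative)
  then show ?thesis by (simp add: DERIV_imp_deriv)
qed

lemma closed_Collect_coincidence: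
  assumes f: "f \<in> C1b" and g: "g \<in> C11"
  shows "closed {x. f x = g x}"
proof -
  have "continuous_on UNIV g"
    using C11_DERIV[OF g] by (meson DERIV_isCont continuous_at_imp_continuous_on)
  then show ?thesis by (intro closed_Collect_eq C1b_continuous(1)[OF f])
qed

lemma C11_coincidence_contact_set:
  assumes f: "f \<in> C1b" and g: "g \<in> C11"
  shows "AE x in lborel. f x = g x \<longrightarrow> (\<exists>N. x \<in> contact_set N f)"
proof -
  define E where "E = {x. f x = g x}"
  note gd = C11_DERIV[OF g]
  obtain L where L: "L-lipschitz_on UNIV (deriv g)" using g by (auto simp: C11_def)
  have L0: "L \<ge> 0" using L lipschitz_on_nonneg by blast
  have Llip: "\<bar>deriv g x - deriv g y\<bar> \<le> L * \<bar>x - y\<bar>" for x y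
    using lipschitz_onD[OF L, of x y] by (simp add: dist_real_def)
  have "closed E" unfolding E_def by (rule closed_Collect_coincidence[OF f g])
  then have E: "E \<in> sets borel" by auto
  show ?thesis using AE_density[OF E]
  proof eventually_elim
    case (elim x)
    show ?case
    proof
      assume "f x = g x"
      then have xE: "x \<in> E" by (simp add: E_def)
      then obtain d where d: "d > 0"
        "\<And>a b. a < x \<Longrightarrow> x < b \<Longrightarrow> b - a < d \<Longrightarrow> measure lborel (E \<inter> {a<..<b}) \<ge> (1 - 1/10) * (b - a)"
        using elim by (metis divide_pos_pos zero_less_numeral zero_less_one)
      \<comment> \<open>A set filling at least 9/10 of \<open>{a<..<b}\<close> cannot lie in a left
        part shorter than that.\<close>
      have found: "\<exists>y\<in>E. c \<le> y \<and> y < b" if c: "a < x" "x < b" "b - a < d" "a < c" "c < b" "c - a < 9/10 * (b - a)" for a b c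
      proof (rule ccontr)
        assume "\<not> ?thesis"
        then have "E \<inter> {a<..<b} \<subseteq> {a<..<c}" by force
        then have "measure lborel (E \<inter> {a<..<b}) \<le> measure lborel {a<..<c}"
          using E c by (intro measure_mono_fmeasurable) (auto simp: fmeasurable_def)
        then show False using d(2)[OF c(1-3)] c by simp
      qed
      \<comment> \<open>Zeros of \<open>f - g\<close> accumulating at \<open>x\<close> force its
        derivative there to vanish.\<close>
      have "x islimpt E" unfolding islimpt_approachable_real
      proof (intro allI impI)
        fix e :: real assume e: "0 < e"
        define h where "h = min e d / 4"
        have h: "h > 0" "2 * h < d" "h < e" using e d by (auto simp: h_def)
        obtain y where "y \<in> E" "x + h/2 \<le> y" "y < x + h"
          using found[of "x - h" "x + h" "x + h/2"] h by auto
        then show "\<exists>x'\<in>E. x' \<noteq> x \<and> \<bar>x' - x\<bar> < e" using h by (intro bexI[of _ y]) auto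
      qed
      have deriv_eq: "deriv f x = deriv g x"
      proof (rule ccontr)
        assume ne: "deriv f x \<noteq> deriv g x"
        have "((\<lambda>y. f y - g y) has_real_derivative (deriv f x - deriv g x)) (at x)"
          by (intro DERIV_diff C1b_DERIV f gd)
        then have "((\<lambda>y. ((f y - g y) - (f x - g x)) / (y - x)) \<longlongrightarrow> deriv f x - deriv g x) (at x)"
          by (simp add: has_field_derivative_iff)
        then have "eventually (\<lambda>y. ((f y - g y) - (f x - g x)) / (y - x) \<noteq> 0) (at x)"
          by (rule tendsto_imp_eventually_ne) (use ne in simp)
        then have "eventually (\<lambda>y. y \<notin> E) (at x)"
          by (rule eventually_mono) (use xE in \<open>auto simp: E_def\<close>)
        then show False using \<open>x islimpt E\<close> by (simp add: islimpt_iff_eventually)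
      qed
      \<comment> \<open>\<open>16 * L\<close> is the constant of L t^2 for \<open>t\<close> up to
        \<open>4 * h\<close>, where \<open>h\<close> is the scale; \<open>N2\<close> makes the
        interval of length \<open>5 * h\<close> short enough for the density bound.\<close>
      obtain N1 :: nat where N1: "max \<bar>x\<bar> (16 * L) \<le> real N1" using real_arch_simple by blast
      obtain N2 where N2: "(1/2) ^ N2 < d / 5" using real_arch_pow_inv[of "d/5" "1/2"] d by auto
      define N where "N = max N1 N2"
      have N: "\<bar>x\<bar> \<le> real N" "16 * L \<le> real N" using N1 by (auto simp: N_def)
      have "x \<in> contact_set N f" unfolding contact_set_def mem_Collect_eq
      proof (intro conjI allI impI)
        show "x \<in> {- real N..real N}" using N by auto
        fix n assume n: "N \<le> n"
        define h where "h = (1/2::real) ^ n"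
        have "h \<le> (1/2) ^ N2" unfolding h_def using n by (intro power_decreasing) (auto simp: N_def)
        then have "5 * h < d" using N2 by linarith
        then have h: "h > 0" "5 * h < d" by (auto simp: h_def)
        have h2: "2 / 2 ^ n = 2 * h" "4 / 2 ^ n = 4 * h" and h4: "real N / 4 ^ n = real N * h\<^sup>2"
          by (simp_all add: h_def half_power quarter_power)
        \<comment> \<open>The left part to be excluded has length \<open>3 * h\<close>, less than
          9/10 of \<open>5 * h\<close>.\<close>
        obtain y where y: "y \<in> E" "x + 2 * h \<le> y" "y < x + 4 * h"
          using found[of "x - h" "x + 4 * h" "x + 2 * h"] h by auto
        define t where "t = y - x"
        have t: "t \<in> {2 * h..4 * h}" "0 < t" "x + t \<in> E" using y h by (auto simp: t_def)
        have "\<bar>f (x + t) - f x - deriv f x * t\<bar> = \<bar>g (x + t) - g x - deriv g x * t\<bar>"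
          using t xE deriv_eq by (simp add: E_def)
        also have "\<dots> \<le> L * t\<^sup>2" by (rule taylor_remainder_le[OF gd t(2) Llip L0])
        also have "\<dots> \<le> L * (4 * h)\<^sup>2" using t L0 by (intro mult_left_mono power_mono) auto
        also have "\<dots> = 16 * L * h\<^sup>2" by (simp add: power_mult_distrib)
        also have "\<dots> \<le> real N * h\<^sup>2" using N by (intro mult_right_mono) auto
        finally show "\<exists>t\<in>{2 / 2 ^ n..4 / 2 ^ n}. \<bar>f (x + t) - f x - deriv f x * t\<bar> \<le> real N / 4 ^ n"
          unfolding h2 h4 using t(1) by blast
      qed
      then show "\<exists>N. x \<in> contact_set N f" by blast
    qed
  qed
qed

text \<open>Contact sets grow with the index, so \<open>contact_set M f\<close> has measure below
  \<open>1 / real N\<close> for every positive \<open>N \<ge> M\<close> and is null. Hence one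
  countable family of conditions handles all \<open>g\<close> at once.\<close>

lemma C11_coincidence_null:
  assumes f: "f \<in> C1b" and g: "g \<in> C11"
    and small: "\<And>N. N \<ge> 1 \<Longrightarrow> measure lborel (contact_set N f) < 1 / real N"
  shows "{x. f x = g x} \<in> null_sets lebesgue"
proof -
  have null: "contact_set M f \<in> null_sets lborel" for M
  proof -
    have fm: "contact_set N f \<in> fmeasurable lborel" for N
      by (rule contact_set_fmeasurable[OF f])
    have "measure lborel (contact_set M f) \<le> 1 / real (Suc N)" if "N \<ge> M" for N
    proof -
      have "measure lborel (contact_set M f) \<le> measure lborel (contact_set (Suc N) f)"
        by (rule measure_mono_fmeasurable) (use fm that contact_set_mono[of M "Suc N" f] in \<open>auto simp: fmeasurable_def\<close>)
      then show ?thesis using small[of "Suc N"] by simp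
    qed
    then have "measure lborel (contact_set M f) \<le> 0"
      using LIMSEQ_le_const[OF LIMSEQ_inverse_real_of_nat, of "measure lborel (contact_set M f)"]
      by (auto simp: inverse_eq_divide)
    then have "measure lborel (contact_set M f) = 0" by (simp add: measure_le_0_iff)
    then show ?thesis using fm[of M] by (auto simp: null_sets_def fmeasurable_def emeasure_eq_ennreal_measure)
  qed
  then have "(\<Union>M. contact_set M f) \<in> null_sets lborel" by blast
  then have "AE x in lborel. x \<notin> (\<Union>M. contact_set M f)" by (rule AE_not_in)
  with C11_coincidence_contact_set[OF f g] have "AE x in lborel. x \<notin> {x. f x = g x}"
    by eventually_elim auto
  moreover have "{x. f x = g x} \<in> sets lborel"
    using closed_Collect_coincidence[OF f g] by auto
  ultimately have "{x. f x = g x} \<in> null_sets lborel" by (simp add: AE_iff_null_sets)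
  then show ?thesis by (rule null_sets_completionI)
qed

section \<open>Approximate differentiability and genericity\<close>

text \<open>By periodicity a single point of the set supplies points arbitrarily far on both
  sides.\<close>

lemma K_set_two_sided:
  assumes "x \<in> K_set \<beta> n"
  shows "two_sided_closed (K_set \<beta> n)"
proof
  show "closed (K_set \<beta> n)" by (rule closed_K_set)
  show "\<exists>c\<in>K_set \<beta> n. c \<le> y" for y
    by (rule bexI[of _ "x + of_int (\<lfloor>y - x\<rfloor>)"]) (auto simp: K_set_add_int[OF assms], linarith)
  show "\<exists>c\<in>K_set \<beta> n. y \<le> c" for y
    by (rule bexI[of _ "x + of_int (\<lceil>y - x\<rceil>)"]) (auto simp: K_set_add_int[OF assms], linarith)
qed

context hoelder_class
begin

lemma deriv_AE_approx_differentiable: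
  assumes f: "f \<in> X"
  shows "AE x in lebesgue. approx_differentiable_at (deriv f) x"
proof -
  note fX = X_space_D[OF f]
  have "AE x in lborel. x \<in> K_set \<beta> n \<longrightarrow> approx_differentiable_at (deriv f) x" if n: "n \<ge> 1" for n
  \<comment> \<open>The set can be empty: if \<open>(\<beta> - 1) * n < 1\<close>, neighbouring
    intervals of \<open>U_set \<beta> n\<close> overlap and cover the line. There is then nothing to
    interpolate from.\<close>
  proof (cases "K_set \<beta> n = {}")
    case False
    then interpret K: two_sided_closed "K_set \<beta> n" using K_set_two_sided by blast
    define \<psi> where "\<psi> = gap_interp (K_set \<beta> n) (deriv f)"
    have "\<bar>\<psi> x - \<psi> y\<bar> \<le> \<Lambda> n * \<bar>x - y\<bar>" for x y unfolding \<psi>_def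
      by (rule K.gap_interp_modulus[OF concave_on_linear, of _ "K_set \<beta> n"])
         (use fX(4)[OF n] K.gap_lo(1) K.gap_hi(1) in auto)
    then have "(\<Lambda> n)-lipschitz_on UNIV \<psi>"
      using \<Lambda>_pos[OF n] by (intro lipschitz_onI) (auto simp: dist_real_def)
    from lipschitz_AE_differentiable[OF this] AE_density[OF borel_closed[OF closed_K_set[of \<beta> n]]]
    show ?thesis
    proof eventually_elim
      case (elim x)
      show ?case
      proof
        assume x: "x \<in> K_set \<beta> n"
        obtain D where D: "(\<psi> has_real_derivative D) (at x)" using elim(1) by blast
        show "approx_differentiable_at (deriv f) x"
          by (rule approx_differentiable_at_lipschitz_extension[OF C1b_continuous(2)[OF fX(1)] closed_K_set D _ x])
             (use elim(2) x in \<open>auto simp: \<psi>_def K.gap_interp_mem\<close>)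
      qed
    qed
  qed auto
  then have "AE x in lborel. \<forall>n. n \<ge> 1 \<longrightarrow> x \<in> K_set \<beta> n \<longrightarrow> approx_differentiable_at (deriv f) x"
    by (subst AE_all_countable) auto
  with AE_K_set[OF \<beta>] have "AE x in lborel. approx_differentiable_at (deriv f) x"
    by eventually_elim auto
  then show ?thesis by (rule AE_completion)
qed

text \<open>\<open>h\<close> mixes the smoothed \<open>f1\<close> with bumps of one fine level
  \<open>k\<close>. At every point of the window outside \<open>U_set \<beta> k\<close> the contact
  condition fails at the scale 2^-k, so the contact set is as small as that neighbourhood.\<close>

lemma small_contact_set_dense:
  assumes cond: "(\<alpha> + 1) * \<beta> < 2" and f: "f \<in> X" and N: "N \<ge> 1" and e: "e > 0"
  shows "\<exists>h\<in>X. C1b_dist f h < e \<and> measure lborel (contact_set N h) < 1 / real N"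
proof -
  interpret M: Metric_space C1b C1b_dist by (rule Metric_space_C1b)
  \<comment> \<open>Room for a point of \<open>{- real N..real N}\<close> plus a step
    \<open>t\<close>, which is at most 4.\<close>
  define R where "R = real N + 4"
  have R: "R > 0" by (simp add: R_def)
  obtain f1 L where f1: "f1 \<in> X" "C1b_dist f f1 \<le> e / 2" and L: "L > 0" and
    lip: "\<And>x y. x \<in> {-R..R} \<Longrightarrow> y \<in> {-R..R} \<Longrightarrow> \<bar>deriv f1 x - deriv f1 y\<bar> \<le> L * \<bar>x - y\<bar>"
    using piecewise_smoothing[OF f R, of "e / 2"] e by auto
  note f1X = X_space_D[OF f1(1)]
  obtain B B' where B: "\<And>x. \<bar>f1 x\<bar> \<le> B" "\<And>x. \<bar>deriv f1 x\<bar> \<le> B'" using C1b_bdd[OF f1X(1)] by blast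
  \<comment> \<open>\<open>W\<close> bounds the \<open>C1b_dist\<close> of \<open>f1\<close> and
    \<open>w\<close>: \<open>B + (2 * R + 2)\<close> for the values plus \<open>B' + 1\<close> for
    the derivatives.\<close>
  define W where "W = 2 * R + 3 + B + B'"
  have W: "W > 0" using B(1)[of 0] B(2)[of 0] R unfolding W_def by linarith
  define \<delta> where "\<delta> = min 1 (e / (4 * W))"
  have \<delta>: "0 < \<delta>" "\<delta> \<le> 1" using e W by (auto simp: \<delta>_def)
  have "\<delta> \<le> e / (4 * W)" by (simp add: \<delta>_def)
  then have \<delta>W: "\<delta> * W \<le> e / 4" using W by (simp add: field_simps)
  define c where "c = min 1 H"
  have c: "c > 0" using H by (simp add: c_def)
  define \<rho> where "\<rho> k = 1 / 2 powr (\<beta> * real k)" for k :: nat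
  \<comment> \<open>\<open>q\<close> is the ratio in the measure bound for \<open>U_set\<close>, and
    \<open>q ^ k\<close> is also 2^k times \<open>\<rho> k\<close>. \<open>p ^ k\<close> is the
    quotient of \<open>\<rho> k powr (1 + \<alpha>)\<close> by 4^-k; it is unbounded because
    \<open>(\<alpha> + 1) * \<beta> < 2\<close>.\<close>
  define q where "q = 2 powr (1 - \<beta>)"
  define p where "p = 2 powr (2 - (\<alpha> + 1) * \<beta>)"
  have q: "0 < q" "q < 1" using \<beta> powr_less_mono[of "1 - \<beta>" 0 2] by (auto simp: q_def)
  have p: "p > 1" using cond powr_less_mono[of 0 "2 - (\<alpha> + 1) * \<beta>" 2] by (simp add: p_def)
  have q0: "(\<lambda>k. C * q ^ k) \<longlonglongrightarrow> 0" for C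
    using tendsto_mult_right_zero[OF LIMSEQ_realpow_zero[of q]] q by simp
  have ev1: "eventually (\<lambda>k. 4 * (real N + 2) * q ^ k < 1 / real N) sequentially"
    by (rule order_tendstoD(2)[OF q0]) (use N in simp)
  have ev2: "eventually (\<lambda>k. 2 * q ^ k < 1) sequentially"
    by (rule order_tendstoD(2)[OF q0]) simp
  have ev3: "eventually (\<lambda>k. p ^ k > (16 * L + real N) * 2 / (\<delta> * c)) sequentially"
  proof -
    obtain m where "(16 * L + real N) * 2 / (\<delta> * c) < p ^ m" using real_arch_pow[OF p] by blast
    moreover have "p ^ m \<le> p ^ k" if "m \<le> k" for k using that p by (intro power_increasing) auto
    ultimately show ?thesis unfolding eventually_sequentially by (meson less_le_trans)
  qed
  have "eventually (\<lambda>k. k \<ge> N \<and> 4 * (real N + 2) * q ^ k < 1 / real N \<and> 2 * q ^ k < 1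
      \<and> p ^ k > (16 * L + real N) * 2 / (\<delta> * c)) sequentially"
    by (intro eventually_conj eventually_ge_at_top ev1 ev2 ev3)
  then obtain k where k: "k \<ge> N" "4 * (real N + 2) * q ^ k < 1 / real N" "2 * q ^ k < 1"
      "p ^ k > (16 * L + real N) * 2 / (\<delta> * c)"
    by (auto dest: eventually_happens)
  define a where "a = (1/2::real) ^ k"
  have a: "a > 0" "a \<le> 1" by (auto simp: a_def power_le_one)
  have a2: "1 / 2 ^ k = a" "2 / 2 ^ k = 2 * a" "4 / 2 ^ k = 4 * a" and a4: "real N / 4 ^ k = real N * a\<^sup>2"
    by (simp_all add: a_def half_power quarter_power)
  have \<rho>a: "2 * \<rho> k < a"
  proof -
    have "q ^ k = 2 powr (real k - \<beta> * real k)"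
      by (simp add: q_def powr_realpow[symmetric] powr_powr algebra_simps)
    also have "\<dots> = 2 ^ k * \<rho> k" by (simp add: \<rho>_def powr_diff powr_realpow)
    finally have "2 * (2 ^ k * \<rho> k) < 1" using k(3) by simp
    then show ?thesis by (simp add: a_def power_one_over field_simps)
  qed
  have \<rho>0: "\<rho> k > 0" by (simp add: \<rho>_def)
  have big: "\<delta> * (c * \<rho> k powr (1 + \<alpha>) / 2) > (16 * L + real N) * a\<^sup>2"
  proof -
    have "\<rho> k = 2 powr (- (\<beta> * real k))" by (simp add: \<rho>_def powr_minus_divide)
    then have "\<rho> k powr (1 + \<alpha>) = 2 powr (- ((\<alpha> + 1) * \<beta> * real k))"
      by (simp add: powr_powr algebra_simps)
    moreover have "a\<^sup>2 = 2 powr (- (2 * real k))"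
      by (simp add: a_def power_one_over powr_minus_divide powr_realpow[symmetric] powr_powr power2_eq_square powr_add[symmetric])
    moreover have "p ^ k = 2 powr (2 * real k - (\<alpha> + 1) * \<beta> * real k)"
      by (simp add: p_def powr_realpow[symmetric] powr_powr algebra_simps)
    ultimately have "\<rho> k powr (1 + \<alpha>) = p ^ k * a\<^sup>2" by (simp add: powr_add[symmetric])
    moreover have "(16 * L + real N) * 2 < p ^ k * (\<delta> * c)" using k(4) \<delta> c by (simp add: pos_divide_less_eq)
    then have "(16 * L + real N) * 2 * a\<^sup>2 < p ^ k * (\<delta> * c) * a\<^sup>2" using a by (intro mult_strict_right_mono) auto
    ultimately show ?thesis by (simp add: algebra_simps)
  qed
  have "k \<ge> 1" using k N by simp
  obtain w where w: "w \<in> X" "\<And>x. \<bar>w x\<bar> \<le> 2 * R + 2" "\<And>x. \<bar>deriv w x\<bar> \<le> 1"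
    and wU: "\<And>x. x \<notin> U_set \<beta> k \<Longrightarrow> deriv w x = 0"
    and wmono: "\<And>x y. x \<le> y \<Longrightarrow> w x \<le> w y"
    and osc: "\<And>j. \<bar>of_int j / 2 ^ k\<bar> \<le> R \<Longrightarrow>
      w (of_int j / 2 ^ k + \<rho> k) - w (of_int j / 2 ^ k - \<rho> k) \<ge> c * \<rho> k powr (1 + \<alpha>) / 2"
    using bumps[OF \<open>k \<ge> 1\<close> R, folded \<rho>_def c_def] by metis
  define h where "h x = (1 - \<delta>) * f1 x + \<delta> * w x" for x
  have h: "h \<in> X" "deriv h = (\<lambda>x. (1 - \<delta>) * deriv f1 x + \<delta> * deriv w x)"
    using X_space_convex[OF f1(1) w(1), of \<delta>] \<delta> unfolding h_def by auto
  note hX = X_space_D[OF h(1)]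
  have "C1b_dist f1 h \<le> \<delta> * (B + (2 * R + 2)) + \<delta> * (B' + 1)"
  proof (rule C1b_dist_le[OF f1X(1) hX(1)])
    fix x
    have "f1 x - h x = \<delta> * (f1 x - w x)" "deriv f1 x - deriv h x = \<delta> * (deriv f1 x - deriv w x)"
      by (simp_all add: h h_def algebra_simps)
    moreover have "\<bar>f1 x - w x\<bar> \<le> B + (2 * R + 2)" "\<bar>deriv f1 x - deriv w x\<bar> \<le> B' + 1"
      using B[of x] w(2,3)[of x] by linarith+
    ultimately show "\<bar>f1 x - h x\<bar> \<le> \<delta> * (B + (2 * R + 2))" "\<bar>deriv f1 x - deriv h x\<bar> \<le> \<delta> * (B' + 1)"
      using \<delta> by (simp_all add: abs_mult)
  qed
  also have "\<dots> = \<delta> * W" by (simp add: W_def algebra_simps)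
  finally have "C1b_dist f h < e"
    using M.triangle[OF X_space_D(1)[OF f] f1X(1) hX(1)] f1(2) \<delta>W e by linarith
  moreover have "contact_set N h \<subseteq> U_set \<beta> k \<inter> {- real N..real N}"
  proof
    fix x assume x: "x \<in> contact_set N h"
    then have xN: "x \<in> {- real N..real N}" by (auto simp: contact_set_def)
    have "x \<in> U_set \<beta> k"
    proof (rule ccontr)
      assume "x \<notin> U_set \<beta> k"
      then have w'x: "deriv w x = 0" by (rule wU)
      have "\<exists>t\<in>{2 / 2 ^ k..4 / 2 ^ k}. \<bar>h (x + t) - h x - deriv h x * t\<bar> \<le> real N / 4 ^ k"
        using x k(1) unfolding contact_set_def by blast
      then obtain t where t: "2 * a \<le> t" "t \<le> 4 * a" "\<bar>h (x + t) - h x - deriv h x * t\<bar> \<le> real N * a\<^sup>2"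
        unfolding a2 a4 by auto
      have t0: "t > 0" using t a by linarith
      \<comment> \<open>The first dyadic centre at distance at least \<open>a / 2\<close> to the
        right of \<open>x\<close>. As \<open>2 * \<rho> k < a\<close>, its whole tent lies between
        \<open>x\<close> and \<open>x + 2 * a\<close>, hence before \<open>x + t\<close>.\<close>
      define j where "j = \<lceil>x * 2 ^ k + 1 / 2\<rceil>"
      have "x * 2 ^ k + 1 / 2 \<le> of_int j" "of_int j < x * 2 ^ k + 3 / 2" unfolding j_def by linarith+
      then have "(x * 2 ^ k + 1 / 2) * a \<le> of_int j * a" "of_int j * a < (x * 2 ^ k + 3 / 2) * a"
        using a(1) by (simp_all add: mult_right_mono)
      moreover have "of_int j / 2 ^ k = of_int j * a" "x * 2 ^ k * a = x"
        by (simp_all add: a_def power_one_over)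
      ultimately have j: "x + a / 2 \<le> of_int j / 2 ^ k" "of_int j / 2 ^ k < x + 3 / 2 * a"
        by (simp_all add: distrib_right)
      have "\<bar>of_int j / 2 ^ k\<bar> \<le> R" unfolding R_def using j xN a unfolding abs_le_iff atLeastAtMost_iff by linarith
      note osc[OF this]
      also have "w (of_int j / 2 ^ k + \<rho> k) - w (of_int j / 2 ^ k - \<rho> k) \<le> w (x + t) - w x"
        by (intro diff_mono wmono) (use j t \<rho>a in linarith)+
      finally have wx: "c * \<rho> k powr (1 + \<alpha>) / 2 \<le> w (x + t) - w x" .
      have "\<bar>f1 (x + t) - f1 x - deriv f1 x * t\<bar> \<le> L * t\<^sup>2"
      proof (rule taylor_remainder_le)
        fix z assume "x \<le> z" "z \<le> x + t"
        then show "\<bar>deriv f1 z - deriv f1 x\<bar> \<le> L * \<bar>z - x\<bar>"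
          using xN t a by (intro lip) (auto simp: R_def)
      qed (use C1b_DERIV[OF f1X(1)] t0 L in auto)
      also have "\<dots> \<le> L * (4 * a)\<^sup>2" using t t0 L by (intro mult_left_mono power_mono) auto
      finally have fx: "\<bar>f1 (x + t) - f1 x - deriv f1 x * t\<bar> \<le> 16 * L * a\<^sup>2" by (simp add: power_mult_distrib)
      \<comment> \<open>Since \<open>deriv w x = 0\<close>, the increment of \<open>w\<close> enters
        in full, with no linear term to cancel it.\<close>
      have "h (x + t) - h x - deriv h x * t = (1 - \<delta>) * (f1 (x + t) - f1 x - deriv f1 x * t) + \<delta> * (w (x + t) - w x)"
        unfolding h(2) h_def w'x by (simp add: algebra_simps)
      moreover have "(1 - \<delta>) * (f1 (x + t) - f1 x - deriv f1 x * t) \<ge> - (16 * L * a\<^sup>2)"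
      proof -
        have "\<bar>(1 - \<delta>) * (f1 (x + t) - f1 x - deriv f1 x * t)\<bar> \<le> 1 * (16 * L * a\<^sup>2)"
          unfolding abs_mult by (rule mult_mono) (use fx \<delta> in auto)
        then show ?thesis by linarith
      qed
      moreover have "\<delta> * (w (x + t) - w x) \<ge> \<delta> * (c * \<rho> k powr (1 + \<alpha>) / 2)"
        using wx \<delta> by (intro mult_left_mono) auto
      ultimately have "h (x + t) - h x - deriv h x * t > real N * a\<^sup>2" using big by (simp add: algebra_simps)
      then show False using t(3) by linarith
    qed
    then show "x \<in> U_set \<beta> k \<inter> {- real N..real N}" using xN by simp
  qed
  then have "measure lborel (contact_set N h) \<le> 4 * (real N + 2) * q ^ k"
  proof -
    assume sub: "contact_set N h \<subseteq> U_set \<beta> k \<inter> {- real N..real N}"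
    have "emeasure lborel (contact_set N h) \<le> ennreal (4 * (real N + 2) * q ^ k)"
    proof (rule order_trans[OF emeasure_mono[OF sub]])
      show "emeasure lborel (U_set \<beta> k \<inter> {- real N..real N}) \<le> ennreal (4 * (real N + 2) * q ^ k)"
        unfolding q_def by (rule emeasure_U_set_le) (use \<beta> in simp)
    qed (use open_U_set in auto)
    then show ?thesis unfolding measure_def using q by (intro enn2real_leI) auto
  qed
  ultimately show ?thesis using h(1) k(2) by (intro bexI[of _ h]) auto
qed

lemma C11_coincidence_residual:
  assumes cond: "(\<alpha> + 1) * \<beta> < 2"
  shows "residual_in (X_topology \<alpha> \<beta> H \<Lambda>) {f \<in> X. \<forall>g\<in>C11. {x. f x = g x} \<in> null_sets lebesgue}"
proof -
  interpret M: Metric_space X C1b_dist by (rule Metric_space_X)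
  \<comment> \<open>For \<open>N = 0\<close> the quotient is 0 and the set is all of
    \<open>X\<close>; only positive \<open>N\<close> enter the union.\<close>
  define \<C> where "\<C> N = {f \<in> X. 1 / real N \<le> measure lborel (contact_set N f)}" for N :: nat
  have closed: "closedin M.mtopology (\<C> N)" for N
    unfolding M.metric_closedin_iff_sequentially_closed
  proof (intro conjI allI impI)
    show "\<C> N \<subseteq> X" by (auto simp: \<C>_def)
    fix \<sigma> l assume \<sigma>: "range \<sigma> \<subseteq> \<C> N \<and> limitin M.mtopology \<sigma> l sequentially"
    then have l: "l \<in> X" "\<And>\<epsilon>. \<epsilon> > 0 \<Longrightarrow> eventually (\<lambda>i. C1b_dist (\<sigma> i) l < \<epsilon>) sequentially"
      by (auto simp: M.limitin_metric elim: eventually_mono)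
    have \<sigma>i: "\<sigma> i \<in> \<C> N" for i using \<sigma> by blast
    have \<sigma>C: "\<sigma> i \<in> C1b" "l \<in> C1b" for i using \<sigma>i[of i] l(1) by (auto simp: \<C>_def X_space_def)
    have "(\<lambda>i. C1b_dist (\<sigma> i) l) \<longlonglongrightarrow> 0"
      by (rule tendstoI) (use l(2) in \<open>simp add: dist_real_def abs_of_nonneg\<close>)
    then have "1 / real N \<le> measure lborel (contact_set N l)"
      by (rule measure_contact_set_limit[rotated 2]) (use \<sigma>i \<sigma>C in \<open>auto simp: \<C>_def\<close>)
    then show "l \<in> \<C> N" using l(1) by (simp add: \<C>_def)
  qed
  have nowhere: "M.mtopology interior_of (\<C> N) = {}" if N: "N \<ge> 1" for N
  proof (rule ccontr)
    assume "M.mtopology interior_of (\<C> N) \<noteq> {}"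
    then obtain f \<epsilon> where f: "f \<in> X" "\<epsilon> > 0" "M.mball f \<epsilon> \<subseteq> \<C> N"
      using M.in_interior_of_mball by blast
    then obtain h where "h \<in> X" "C1b_dist f h < \<epsilon>" "measure lborel (contact_set N h) < 1 / real N"
      using small_contact_set_dense[OF cond f(1) N f(2)] by blast
    moreover from this have "h \<in> \<C> N" using f by auto
    ultimately show False by (simp add: \<C>_def)
  qed
  have cover: "X - {f \<in> X. \<forall>g\<in>C11. {x. f x = g x} \<in> null_sets lebesgue} \<subseteq> \<Union>(\<C> ` {1..})"
  proof
    fix f assume "f \<in> X - {f \<in> X. \<forall>g\<in>C11. {x. f x = g x} \<in> null_sets lebesgue}"
    then obtain g where fg: "f \<in> X" "g \<in> C11" "{x. f x = g x} \<notin> null_sets lebesgue" by blast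
    then obtain N where "N \<ge> 1" "\<not> measure lborel (contact_set N f) < 1 / real N"
      using C11_coincidence_null[OF X_space_D(1)[OF fg(1)] fg(2)] by blast
    then show "f \<in> \<Union>(\<C> ` {1..})" using fg(1) by (auto simp: \<C>_def not_less)
  qed
  show ?thesis unfolding residual_in_def M.topspace_mtopology
    by (intro conjI exI[of _ "\<C> ` {1..}"]) (use closed nowhere cover in auto)
qed

end

theorem theorem2p1:
  fixes \<alpha> \<beta> H :: real and \<Lambda> :: "nat \<Rightarrow> real"
  assumes "0 < \<alpha>" and "\<alpha> < 1" and "\<beta> > 1" and "H > 0"
    and "mono_on {1..} \<Lambda>"
    and "\<And>n. n \<ge> 1 \<Longrightarrow> \<Lambda> n \<ge> 2 powr ((1 - \<alpha>) * \<beta> * real n)"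
  shows "(\<forall>f \<in> X_space \<alpha> \<beta> H \<Lambda>. AE x in lebesgue. approx_differentiable_at (deriv f) x) \<and>
    ((\<alpha> + 1) * \<beta> < 2 \<longrightarrow>
      residual_in (X_topology \<alpha> \<beta> H \<Lambda>)
        {f \<in> X_space \<alpha> \<beta> H \<Lambda>. \<forall>g \<in> C11. {x. f x = g x} \<in> null_sets lebesgue})"
proof -
  interpret hoelder_class \<alpha> \<beta> H \<Lambda> by unfold_locales (use assms in auto)
  show ?thesis using deriv_AE_approx_differentiable C11_coincidence_residual by blast
qed

end
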